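(* Let $r\ge 3$, let $H$ be a connected $r$-graph and let $G\in\mathcal T(r,r-2)\cup\mathcal T(r,1)$. If $H\prec G$, then $H\cong G$.
   Context: All graphs are finite and may have parallel edges but no loops. For $X\subseteq V(G)$, $\partial_G(X)$ is the set of edges of $G$ with exactly one end in $X$; $\partial_G(v)=\partial_G(\{v\})$. An $r$-regular graph $G$ is an $r$-graph if $|\partial_G(X)|\ge r$ for every $X\subseteq V(G)$ of odd cardinality. For an $r$-graph $G$, $\pi(G)$ is the largest integer $t$ such that $G$ has $t$ pairwise disjoint perfect matchings. $\mathcal T(r,k)$ is the set of all $r$-graphs $G$ with $\pi(G)=k$ that have the minimum number of vertices among all $r$-graphs with $\pi=k$. An $H$-coloring of $G$ is a mapping $f\colon E(G)\to E(H)$ such that $f(e_1)\ne f(e_2)$ for adjacent edges $e_1,e_2$ of $G$, and for every $v\in V(G)$ there is $u\in V(H)$ with $f(\partial_G(v))=\partial_H(u)$. $H\prec G$ ("$H$ colors $G$") means that such a mapping exists. *)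

theory Defs
  imports Main
begin

record ('v, 'e) mgraph =
  verts :: "'v set"
  edges :: "'e set"
  ends  :: "'e \<Rightarrow> 'v set"

text \<open>Every edge has exactly two distinct ends, so loops are excluded; parallel edges are distinct
  elements of \<open>edges G\<close> with the same \<open>ends\<close>. As usual, the vertex set is non-empty; this is also
  what makes the maximum in \<open>pm_number\<close> below exist.\<close>

definition multigraph :: "('v, 'e) mgraph \<Rightarrow> bool" where
  "multigraph G \<longleftrightarrow>
     finite (verts G) \<and> verts G \<noteq> {} \<and> finite (edges G) \<and>
     (\<forall>e\<in>edges G. ends G e \<subseteq> verts G \<and> card (ends G e) = 2)"

definition boundary :: "('v, 'e) mgraph \<Rightarrow> 'v set \<Rightarrow> 'e set" where
  "boundary G X = {e \<in> edges G. card (ends G e \<inter> X) = 1}"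

definition regular :: "nat \<Rightarrow> ('v, 'e) mgraph \<Rightarrow> bool" where
  "regular r G \<longleftrightarrow> multigraph G \<and> (\<forall>v\<in>verts G. card (boundary G {v}) = r)"

definition r_graph :: "nat \<Rightarrow> ('v, 'e) mgraph \<Rightarrow> bool" where
  "r_graph r G \<longleftrightarrow>
     regular r G \<and> (\<forall>X\<subseteq>verts G. odd (card X) \<longrightarrow> r \<le> card (boundary G X))"

definition connected_graph :: "('v, 'e) mgraph \<Rightarrow> bool" where
  "connected_graph G \<longleftrightarrow>
     (\<forall>u\<in>verts G. \<forall>v\<in>verts G. (u, v) \<in> {(x, y). \<exists>e\<in>edges G. ends G e = {x, y}}\<^sup>*)"

definition perfect_matching :: "('v, 'e) mgraph \<Rightarrow> 'e set \<Rightarrow> bool" where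
  "perfect_matching G M \<longleftrightarrow> M \<subseteq> edges G \<and> (\<forall>v\<in>verts G. \<exists>!e. e \<in> M \<and> v \<in> ends G e)"

text \<open>The parameter \<open>\<pi>(G)\<close>. Perfect matchings of a non-empty graph are non-empty, so a family of
  \<open>t\<close> pairwise disjoint ones is the same as a set of \<open>t\<close> of them that are pairwise disjoint.\<close>

definition pm_number :: "('v, 'e) mgraph \<Rightarrow> nat" where
  "pm_number G =
     (GREATEST t. \<exists>F. (\<forall>M\<in>F. perfect_matching G M) \<and> pairwise disjnt F \<and> card F = t)"

text \<open>The set \<open>\<T>(r,k)\<close>, for graphs over arbitrary vertex and edge types. The competing graphs
  range over multigraphs with vertices and edges in \<^typ>\<open>nat\<close>; as every finite multigraph is
  isomorphic to one of these, this is the minimum over all \<open>r\<close>-graphs.\<close>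

definition min_r_graphs :: "nat \<Rightarrow> nat \<Rightarrow> ('v, 'e) mgraph set" where
  "min_r_graphs r k =
     {G. r_graph r G \<and> pm_number G = k \<and>
         (\<forall>G' :: (nat, nat) mgraph. r_graph r G' \<and> pm_number G' = k \<longrightarrow>
            card (verts G) \<le> card (verts G'))}"

definition adjacent_edges :: "('v, 'e) mgraph \<Rightarrow> 'e \<Rightarrow> 'e \<Rightarrow> bool" where
  "adjacent_edges G e1 e2 \<longleftrightarrow>
     e1 \<in> edges G \<and> e2 \<in> edges G \<and> e1 \<noteq> e2 \<and> ends G e1 \<inter> ends G e2 \<noteq> {}"

definition H_coloring :: "('v, 'e) mgraph \<Rightarrow> ('w, 'd) mgraph \<Rightarrow> ('d \<Rightarrow> 'e) \<Rightarrow> bool" where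
  "H_coloring H G f \<longleftrightarrow>
     f ` edges G \<subseteq> edges H \<and>
     (\<forall>e1 e2. adjacent_edges G e1 e2 \<longrightarrow> f e1 \<noteq> f e2) \<and>
     (\<forall>v\<in>verts G. \<exists>u\<in>verts H. f ` boundary G {v} = boundary H {u})"

definition colors :: "('v, 'e) mgraph \<Rightarrow> ('w, 'd) mgraph \<Rightarrow> bool" (infix "\<prec>" 50) where
  "H \<prec> G \<longleftrightarrow> (\<exists>f. H_coloring H G f)"

definition graph_iso :: "('v, 'e) mgraph \<Rightarrow> ('w, 'd) mgraph \<Rightarrow> bool" (infix "\<cong>" 50) where
  "H \<cong> G \<longleftrightarrow>
     (\<exists>\<phi> \<psi>. bij_betw \<phi> (verts H) (verts G) \<and> bij_betw \<psi> (edges H) (edges G) \<and>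
            (\<forall>e\<in>edges H. ends G (\<psi> e) = \<phi> ` ends H e))"

end

theory Submission
  imports Defs
begin

text \<open>
Let \<open>f\<close> be an \<open>H\<close>-coloring of \<open>G\<close> and choose for each vertex \<open>v\<close> of \<open>G\<close> a vertex \<open>F v\<close> of \<open>H\<close> such
that \<open>f\<close> maps the edges at \<open>v\<close> bijectively to the edges at \<open>F v\<close>. Two facts drive the proof.

\<^item> Preimages of perfect matchings under \<open>f\<close> are perfect matchings, so \<open>G\<close> has at least as many pairwise
disjoint ones as any \<open>r\<close>-graph that colors it (\<open>packs_if_local_coloring\<close>). Minimality of \<open>G\<close> therefore
bounds the order of \<^emph>\<open>every\<close> \<open>r\<close>-graph that colors \<open>G\<close> from below by the order of \<open>G\<close>
(\<open>card_verts_le_if_local_coloring\<close>).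

\<^item> For an edge \<open>e\<close> of \<open>H\<close> with ends \<open>u\<close> and \<open>w\<close>, the edges of color \<open>e\<close> match the set of vertices that
\<open>F\<close> sends to \<open>u\<close> or \<open>w\<close>. So the fibres over \<open>u\<close> and \<open>w\<close> have the same parity, and as \<open>H\<close> is connected,
all fibres have the same parity (\<open>fibres_same_parity\<close>).

If \<open>F\<close> is onto, the first fact makes it a bijection, and then \<open>f\<close> is an isomorphism. If some fibre is
empty, all fibres are even, so the image \<open>W\<close> of \<open>F\<close> has at most half as many vertices as \<open>G\<close>. Cutting
\<open>H\<close> down to \<open>W\<close> leaves half-edges where edges used to leave \<open>W\<close>. Pairs of half-edges are joined to
edges, in such a way that odd cuts keep at least \<open>r\<close> edges, until no half-edge remains or exactly \<open>r\<close>
remain; in the latter case one new vertex absorbs them (\<open>ex_r_graph_coloring\<close>). The result is an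
\<open>r\<close>-graph that colors \<open>G\<close> and has at most \<open>|W| + 1\<close> vertices, which is less than the order of \<open>G\<close>
unless \<open>G\<close> has only two vertices; but then \<open>G\<close> has \<open>r\<close> disjoint perfect matchings.

The first fact needs, for each \<open>r\<close>-graph \<open>K\<close> with \<open>\<pi>(K) \<le> k\<close>, an \<open>r\<close>-graph with \<open>\<pi> = k\<close> and at
most as many vertices as \<open>K\<close>.
For \<open>k = 1\<close> this is \<open>K\<close> itself, because every \<open>r\<close>-graph has a perfect matching by Tutte's theorem
(\<open>packs_one_if_r_graph\<close>). For \<open>k = r - 2\<close> consider a smallest \<open>r\<close>-graph with \<open>\<pi> < r\<close>. It has no odd cut
of size \<open>r\<close> with at least two vertices on both sides, since edge colorings of the two contractions could
be glued. By parity all such cuts have at least \<open>r + 2\<close> edges, and so replacing two disjoint edges by two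
others on the same four vertices again gives an \<open>r\<close>-graph. Among the smallest graphs choose one with
a largest bundle of parallel edges, and enlarge the bundle by such a switch: the new graph has \<open>r\<close>
disjoint perfect matchings, and at most two of them contain a new edge
(\<open>ex_r_graph_packs_minus_two\<close>).
\<close>

section \<open>Edge cuts in graphs with half-edges\<close>

lemma mem_boundary_singleton [simp]: "e \<in> boundary G {v} \<longleftrightarrow> e \<in> edges G \<and> v \<in> ends G e"
proof -
  have "card (ends G e \<inter> {v}) = 1 \<longleftrightarrow> v \<in> ends G e"
    by (cases "v \<in> ends G e") auto
  then show ?thesis by (simp add: boundary_def)
qed

lemma card_doubleton_Int_eq_1: "p \<noteq> q \<Longrightarrow> card ({p, q} \<inter> X) = 1 \<longleftrightarrow> (p \<in> X \<longleftrightarrow> q \<notin> X)"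
  by (cases "p \<in> X"; cases "q \<in> X") auto

lemma card_singleton_Int_eq_1: "card ({p} \<inter> X) = 1 \<longleftrightarrow> p \<in> X"
  by (cases "p \<in> X") auto

text \<open>An edge with only one end is a half-edge. It counts for the cut of every vertex set that contains its
end, so the half-edges are the cut of the whole vertex set (\<open>mem_boundary_verts\<close> below).\<close>

definition semi_r_graph :: "nat \<Rightarrow> ('v, 'e) mgraph \<Rightarrow> bool" where
  "semi_r_graph r K \<longleftrightarrow>
     finite (verts K) \<and> finite (edges K) \<and>
     (\<forall>e\<in>edges K. ends K e \<subseteq> verts K \<and> (card (ends K e) = 1 \<or> card (ends K e) = 2)) \<and>
     (\<forall>v\<in>verts K. card (boundary K {v}) = r) \<and>
     (\<forall>X\<subseteq>verts K. odd (card X) \<longrightarrow> r \<le> card (boundary K X))"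

lemma r_graph_iff_semi_r_graph:
  "r_graph r G \<longleftrightarrow>
     semi_r_graph r G \<and> verts G \<noteq> {} \<and> (\<forall>e\<in>edges G. card (ends G e) = 2)"
  unfolding r_graph_def regular_def multigraph_def semi_r_graph_def by blast

lemma r_graphD:
  assumes "r_graph r G"
  shows "finite (verts G)" "finite (edges G)" "verts G \<noteq> {}"
    "\<And>e. e \<in> edges G \<Longrightarrow> ends G e \<subseteq> verts G" "\<And>e. e \<in> edges G \<Longrightarrow> card (ends G e) = 2"
    "\<And>v. v \<in> verts G \<Longrightarrow> card (boundary G {v}) = r"
    "\<And>X. X \<subseteq> verts G \<Longrightarrow> odd (card X) \<Longrightarrow> r \<le> card (boundary G X)"
  using assms unfolding r_graph_def regular_def multigraph_def by blast+

lemma semi_r_graphD: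
  assumes "semi_r_graph r K"
  shows "finite (verts K)" "finite (edges K)"
    "\<And>e. e \<in> edges K \<Longrightarrow> ends K e \<subseteq> verts K"
    "\<And>v. v \<in> verts K \<Longrightarrow> card (boundary K {v}) = r"
    "\<And>X. X \<subseteq> verts K \<Longrightarrow> odd (card X) \<Longrightarrow> r \<le> card (boundary K X)"
  using assms unfolding semi_r_graph_def by blast+

lemma semi_r_graph_ends_cases:
  assumes "semi_r_graph r K" and "e \<in> edges K"
  obtains p where "ends K e = {p}" "p \<in> verts K"
    | p q where "ends K e = {p, q}" "p \<noteq> q" "p \<in> verts K" "q \<in> verts K"
proof -
  have sub: "ends K e \<subseteq> verts K" and c: "card (ends K e) = 1 \<or> card (ends K e) = 2"
    using assms unfolding semi_r_graph_def by blast+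
  from c show thesis
  proof
    assume "card (ends K e) = 1"
    then obtain p where "ends K e = {p}" using card_1_singletonE by blast
    then show thesis using sub that(1) by auto
  next
    assume "card (ends K e) = 2"
    then obtain p q where "ends K e = {p, q}" "p \<noteq> q" by (auto simp: card_2_iff)
    then show thesis using sub that(2) by auto
  qed
qed

lemma finite_boundary [simp]: "finite (edges G) \<Longrightarrow> finite (boundary G X)"
  by (simp add: boundary_def)

lemma card_boundary_conv_sum:
  "finite (edges G) \<Longrightarrow> card (boundary G X) = (\<Sum>e\<in>edges G. of_bool (card (ends G e \<inter> X) = 1))"
  by (simp add: boundary_def sum.If_cases of_bool_def Int_def)

text \<open>Summing the degrees over \<open>X\<close> counts the edges of the cut once and the edges inside \<open>X\<close> twice.\<close>

lemma even_card_boundary: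
  assumes K: "semi_r_graph r K" and X: "X \<subseteq> verts K"
  shows "even (card (boundary K X)) \<longleftrightarrow> even (r * card X)"
proof -
  note fin = semi_r_graphD(1,2)[OF K]
  have finX: "finite X" using X fin(1) by (rule finite_subset)
  have "r * card X = (\<Sum>v\<in>X. card (boundary K {v}))"
    using semi_r_graphD(4)[OF K] X by (simp add: subset_iff)
  also have "\<dots> = (\<Sum>v\<in>X. \<Sum>e\<in>edges K. of_bool (v \<in> ends K e))"
    using fin by (simp add: card_boundary_conv_sum Int_insert_right)
  also have "\<dots> = (\<Sum>e\<in>edges K. \<Sum>v\<in>X. of_bool (v \<in> ends K e))"
    by (rule sum.swap)
  also have "\<dots> = (\<Sum>e\<in>edges K. card (ends K e \<inter> X))"
    using finX by (simp add: of_bool_def sum.If_cases Int_commute)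
  also have "\<dots> = (\<Sum>e\<in>edges K. of_bool (card (ends K e \<inter> X) = 1) + 2 * of_bool (card (ends K e \<inter> X) = 2))"
  proof (rule sum.cong[OF refl])
    fix e assume "e \<in> edges K"
    then have "card (ends K e \<inter> X) \<le> 2"
      by (rule semi_r_graph_ends_cases[OF K]) (auto simp: Int_insert_left)
    then have "card (ends K e \<inter> X) \<in> {0, 1, 2}" by auto
    then show "card (ends K e \<inter> X)
      = of_bool (card (ends K e \<inter> X) = 1) + 2 * of_bool (card (ends K e \<inter> X) = 2)"
      by auto
  qed
  also have "\<dots> = card (boundary K X) + 2 * (\<Sum>e\<in>edges K. of_bool (card (ends K e \<inter> X) = 2))"
    using fin by (simp only: sum.distrib sum_distrib_left[symmetric] card_boundary_conv_sum)
  finally show ?thesis by (metis even_add even_mult_iff even_numeral)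
qed

lemma boundary_submodular:
  assumes K: "semi_r_graph r K"
  shows "card (boundary K (X \<inter> Y)) + card (boundary K (X \<union> Y))
    \<le> card (boundary K X) + card (boundary K Y)"
proof -
  have fin: "finite (edges K)" using K by (rule semi_r_graphD)
  have "(\<Sum>e\<in>edges K. of_bool (card (ends K e \<inter> (X \<inter> Y)) = 1) + of_bool (card (ends K e \<inter> (X \<union> Y)) = 1))
     \<le> (\<Sum>e\<in>edges K. of_bool (card (ends K e \<inter> X) = 1) + (of_bool (card (ends K e \<inter> Y) = 1) :: nat))"
  proof (rule sum_mono)
    fix e assume "e \<in> edges K"
    then show "of_bool (card (ends K e \<inter> (X \<inter> Y)) = 1) + of_bool (card (ends K e \<inter> (X \<union> Y)) = 1)
     \<le> of_bool (card (ends K e \<inter> X) = 1) + (of_bool (card (ends K e \<inter> Y) = 1) :: nat)"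
    proof (rule semi_r_graph_ends_cases[OF K])
      fix p assume p: "ends K e = {p}"
      show ?thesis unfolding p card_singleton_Int_eq_1 by auto
    next
      fix p q assume pq: "ends K e = {p, q}" "p \<noteq> q"
      show ?thesis unfolding pq(1) card_doubleton_Int_eq_1[OF pq(2)] by auto
    qed
  qed
  then show ?thesis using fin by (simp only: card_boundary_conv_sum sum.distrib)
qed

text \<open>The half-edge at a common vertex lies in both cuts on the right and in neither on the left; this is
where the extra 2 comes from.\<close>

lemma boundary_posimodular:
  assumes K: "semi_r_graph r K" and h: "h \<in> edges K" "ends K h = {a}" "a \<in> X \<inter> Y"
  shows "card (boundary K (X - Y)) + card (boundary K (Y - X)) + 2
    \<le> card (boundary K X) + card (boundary K Y)"
proof -
  have fin: "finite (edges K)" using K by (rule semi_r_graphD)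
  have two: "(\<Sum>e\<in>edges K. if e = h then 2 else 0) = (2::nat)"
    using fin h by simp
  have "(\<Sum>e\<in>edges K. of_bool (card (ends K e \<inter> (X - Y)) = 1) + of_bool (card (ends K e \<inter> (Y - X)) = 1)
       + (if e = h then 2 else 0))
     \<le> (\<Sum>e\<in>edges K. of_bool (card (ends K e \<inter> X) = 1) + (of_bool (card (ends K e \<inter> Y) = 1) :: nat))"
  proof (rule sum_mono)
    fix e assume e: "e \<in> edges K"
    show "of_bool (card (ends K e \<inter> (X - Y)) = 1) + of_bool (card (ends K e \<inter> (Y - X)) = 1)
       + (if e = h then 2 else 0)
     \<le> of_bool (card (ends K e \<inter> X) = 1) + (of_bool (card (ends K e \<inter> Y) = 1) :: nat)"
    proof (cases "e = h")
      case True
      then show ?thesis using h by (simp only: card_singleton_Int_eq_1) auto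
    next
      case False
      from e show ?thesis
      proof (rule semi_r_graph_ends_cases[OF K])
        fix p assume p: "ends K e = {p}"
        show ?thesis unfolding p card_singleton_Int_eq_1 using False by auto
      next
        fix p q assume pq: "ends K e = {p, q}" "p \<noteq> q"
        show ?thesis unfolding pq(1) card_doubleton_Int_eq_1[OF pq(2)] using False by auto
      qed
    qed
  qed
  then show ?thesis using fin by (simp only: card_boundary_conv_sum sum.distrib two)
qed

text \<open>Edges that leave \<open>W\<close> become half-edges.\<close>

definition restrict_graph :: "('v, 'e) mgraph \<Rightarrow> 'v set \<Rightarrow> ('v, 'e) mgraph" where
  "restrict_graph H W =
     \<lparr>verts = W, edges = {e \<in> edges H. ends H e \<inter> W \<noteq> {}}, ends = \<lambda>e. ends H e \<inter> W\<rparr>"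

lemma restrict_graph_simps [simp]:
  "verts (restrict_graph H W) = W"
  "edges (restrict_graph H W) = {e \<in> edges H. ends H e \<inter> W \<noteq> {}}"
  "ends (restrict_graph H W) e = ends H e \<inter> W"
  by (simp_all add: restrict_graph_def)

lemma boundary_restrict_graph [simp]:
  assumes "X \<subseteq> W"
  shows "boundary (restrict_graph H W) X = boundary H X"
proof -
  have "ends H e \<inter> W \<inter> X = ends H e \<inter> X" for e using assms by auto
  moreover have "ends H e \<inter> W \<noteq> {}" if "card (ends H e \<inter> X) = 1" for e
  proof -
    have "ends H e \<inter> X \<noteq> {}" using that by auto
    then show ?thesis using assms by auto
  qed
  ultimately show ?thesis unfolding boundary_def restrict_graph_simps by auto
qed

lemma semi_r_graph_restrict_graph:
  assumes "r_graph r H" and W: "W \<subseteq> verts H"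
  shows "semi_r_graph r (restrict_graph H W)"
proof -
  note H = r_graphD[OF assms(1)]
  have "card (ends H e \<inter> W) = 1 \<or> card (ends H e \<inter> W) = 2"
    if "e \<in> edges H" "ends H e \<inter> W \<noteq> {}" for e
  proof -
    have "card (ends H e \<inter> W) \<le> 2" "finite (ends H e)"
      using H(5)[OF that(1)] card_mono[of "ends H e" "ends H e \<inter> W"] card_ge_0_finite[of "ends H e"]
      by auto
    moreover have "card (ends H e \<inter> W) \<noteq> 0"
      using that(2) \<open>finite (ends H e)\<close> by simp
    ultimately show ?thesis by linarith
  qed
  moreover have "finite W" using W H(1) by (rule finite_subset)
  moreover have "card (boundary (restrict_graph H W) {v}) = r" if "v \<in> W" for v
    using H(6)[of v] W that by (subst boundary_restrict_graph) auto
  moreover have "r \<le> card (boundary (restrict_graph H W) X)" if "X \<subseteq> W" "odd (card X)" for X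
    using H(7)[of X] W that by simp
  ultimately show ?thesis
    unfolding semi_r_graph_def using H by simp
qed

text \<open>All half-edges are attached to one additional vertex.\<close>

definition cap :: "('v, 'e) mgraph \<Rightarrow> 'v \<Rightarrow> ('v, 'e) mgraph" where
  "cap K z = K\<lparr>verts := insert z (verts K),
     ends := \<lambda>e. if card (ends K e) = 1 then insert z (ends K e) else ends K e\<rparr>"

lemma cap_simps [simp]:
  "verts (cap K z) = insert z (verts K)"
  "edges (cap K z) = edges K"
  "ends (cap K z) e = (if card (ends K e) = 1 then insert z (ends K e) else ends K e)"
  by (simp_all add: cap_def)

lemma boundary_cap:
  assumes "z \<notin> X"
  shows "boundary (cap K z) X = boundary K X"
proof -
  have "ends (cap K z) e \<inter> X = ends K e \<inter> X" for e using assms by auto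
  then show ?thesis unfolding boundary_def by simp
qed

lemma boundary_Diff:
  assumes "\<And>e. e \<in> edges G \<Longrightarrow> ends G e \<subseteq> verts G \<and> card (ends G e) = 2"
  shows "boundary G (verts G - X) = boundary G X"
proof -
  have "card (ends G e \<inter> (verts G - X)) = 1 \<longleftrightarrow> card (ends G e \<inter> X) = 1" if "e \<in> edges G" for e
  proof -
    obtain p q where pq: "ends G e = {p, q}" "p \<noteq> q" using assms[OF \<open>e \<in> edges G\<close>] by (auto simp: card_2_iff)
    then have "p \<in> verts G" "q \<in> verts G" using assms[OF \<open>e \<in> edges G\<close>] by auto
    then show ?thesis unfolding pq(1) card_doubleton_Int_eq_1[OF pq(2)] by auto
  qed
  then show ?thesis unfolding boundary_def by auto
qed

text \<open>A set that contains the new vertex has the same cut as its complement, which is an odd set of old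
vertices because the total number of vertices is even.\<close>

lemma r_graph_cap:
  assumes K: "semi_r_graph r K" and z: "z \<notin> verts K" and odd: "odd (card (verts K))"
    and r: "card (boundary K (verts K)) = r"
  shows "r_graph r (cap K z)"
proof -
  note KD = semi_r_graphD[OF K]
  have 1: "ends (cap K z) e \<subseteq> verts (cap K z)" "card (ends (cap K z) e) = 2" if "e \<in> edges K" for e
  proof -
    have "ends (cap K z) e \<subseteq> verts (cap K z) \<and> card (ends (cap K z) e) = 2"
      using that
    proof (rule semi_r_graph_ends_cases[OF K])
      fix p assume "ends K e = {p}" "p \<in> verts K"
      moreover from this have "p \<noteq> z" using z by blast
      ultimately show ?thesis by simp
    next
      fix p q assume "ends K e = {p, q}" "p \<noteq> q" "p \<in> verts K" "q \<in> verts K"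
      then show ?thesis by simp
    qed
    then show "ends (cap K z) e \<subseteq> verts (cap K z)" "card (ends (cap K z) e) = 2" by blast+
  qed
  have compl: "boundary (cap K z) (verts (cap K z) - X) = boundary (cap K z) X" for X
    by (rule boundary_Diff) (use 1 in auto)
  have "card (boundary (cap K z) {v}) = r" if "v \<in> insert z (verts K)" for v
  proof (cases "v = z")
    case True
    have "verts (cap K z) - verts K = {z}" using z by auto
    then show ?thesis using compl[of "verts K"] boundary_cap[OF z] r True by metis
  next
    case False
    then show ?thesis using that KD(4)[of v] boundary_cap[of z "{v}" K] by simp
  qed
  moreover have "r \<le> card (boundary (cap K z) X)" if X: "X \<subseteq> insert z (verts K)" "odd (card X)" for X
  proof (cases "z \<in> X")
    case False
    then show ?thesis using X KD(5)[of X] boundary_cap[of z X K] by (simp add: subset_insert)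
  next
    case True
    let ?Y = "insert z (verts K) - X"
    have "finite X" using X(1) KD(1) finite_subset by blast
    then have "card ?Y = Suc (card (verts K)) - card X" "card X \<le> Suc (card (verts K))"
      using X(1) KD(1) z card_mono[OF _ X(1)] by (simp_all add: card_Diff_subset)
    then have "odd (card ?Y)" using odd X(2) by simp
    then have "r \<le> card (boundary K ?Y)" using True by (intro KD(5)) auto
    then show ?thesis using compl[of X] boundary_cap[of z ?Y K] True by simp
  qed
  ultimately show ?thesis
    unfolding r_graph_def regular_def multigraph_def using KD 1 by simp
qed

lemma even_card_verts:
  assumes "r_graph r G" and "r > 0"
  shows "even (card (verts G))"
proof (rule ccontr)
  assume "odd (card (verts G))"
  then have "r \<le> card (boundary G (verts G))" using r_graphD(7)[OF assms(1)] by simp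
  moreover have "boundary G (verts G - {}) = boundary G {}"
    by (rule boundary_Diff) (use r_graphD[OF assms(1)] in auto)
  moreover have "boundary G {} = {}" by (simp add: boundary_def)
  ultimately show False using assms(2) by simp
qed

section \<open>Disjoint perfect matchings as edge colorings\<close>

text \<open>Each color \<open>i < t\<close> is a perfect matching; colors \<open>\<ge> t\<close> mark the edges outside of these \<open>t\<close> disjoint
matchings.\<close>

definition packing :: "('v, 'e) mgraph \<Rightarrow> nat \<Rightarrow> ('e \<Rightarrow> nat) \<Rightarrow> bool" where
  "packing G t c \<longleftrightarrow> (\<forall>v\<in>verts G. \<forall>i<t. \<exists>!e. e \<in> boundary G {v} \<and> c e = i)"

definition packs :: "('v, 'e) mgraph \<Rightarrow> nat \<Rightarrow> bool" where
  "packs G t \<longleftrightarrow> (\<exists>c. packing G t c)"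

lemma packs_mono: "packs G t \<Longrightarrow> s \<le> t \<Longrightarrow> packs G s"
  unfolding packs_def packing_def by (meson less_le_trans)

lemma packing_subset_image:
  assumes "packing G t c" "v \<in> verts G"
  shows "{..<t} \<subseteq> c ` boundary G {v}"
  using assms unfolding packing_def by (fastforce simp: image_iff)

lemma packs_le:
  assumes G: "r_graph r G" and "packs G t"
  shows "t \<le> r"
proof -
  obtain c v where cv: "packing G t c" "v \<in> verts G"
    using assms r_graphD(3)[OF G] unfolding packs_def by blast
  have fin: "finite (boundary G {v})" using r_graphD(2)[OF G] by simp
  have "t \<le> card (c ` boundary G {v})"
    using card_mono[OF finite_imageI[OF fin] packing_subset_image[OF cv]] by simp
  also have "\<dots> \<le> r" using card_image_le[OF fin] r_graphD(6)[OF G cv(2)] by simp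
  finally show ?thesis .
qed

lemma perfect_matching_iff:
  "perfect_matching G M \<longleftrightarrow>
     M \<subseteq> edges G \<and> (\<forall>v\<in>verts G. \<exists>!e. e \<in> boundary G {v} \<and> e \<in> M)"
proof (cases "M \<subseteq> edges G")
  case True
  then have "e \<in> boundary G {v} \<and> e \<in> M \<longleftrightarrow> e \<in> M \<and> v \<in> ends G e" for e v by auto
  then show ?thesis unfolding perfect_matching_def by simp
qed (simp add: perfect_matching_def)

lemma le_pm_number_iff_packs:
  assumes G: "r_graph r G"
  shows "t \<le> pm_number G \<longleftrightarrow> packs G t"
proof -
  define P where "P t \<longleftrightarrow> (\<exists>F. (\<forall>M\<in>F. perfect_matching G M) \<and> pairwise disjnt F \<and> card F = t)" for t
  have pm: "pm_number G = (GREATEST t. P t)" unfolding pm_number_def P_def ..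
  have P_if: "P t" if t: "packs G t" for t
  proof -
    obtain c where c: "packing G t c" using t unfolding packs_def by blast
    define M where "M i = {e \<in> edges G. c e = i}" for i
    have 1: "perfect_matching G (M i)" if "i < t" for i
      unfolding perfect_matching_iff M_def using c that
      by (auto simp: packing_def conj_ac)
    obtain v where v: "v \<in> verts G" using r_graphD(3)[OF G] by blast
    have 2: "M i \<noteq> {}" if "i < t" for i
      using 1[OF that] v unfolding perfect_matching_iff by blast
    have 3: "disjnt (M i) (M j)" if "i \<noteq> j" for i j
      using that unfolding M_def disjnt_def by auto
    have "inj_on M {..<t}"
    proof (rule inj_onI)
      fix i j assume "i \<in> {..<t}" "j \<in> {..<t}" "M i = M j"
      then show "i = j" using 2[of i] 3[of i j] by (auto simp: disjnt_def)
    qed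
    then have "card (M ` {..<t}) = t" by (simp add: card_image)
    moreover have "pairwise disjnt (M ` {..<t})" using 3 by (intro pairwise_imageI) simp
    ultimately show "P t" using 1 unfolding P_def by (intro exI[of _ "M ` {..<t}"]) auto
  qed
  have packs_if: "packs G t" if t: "P t" for t
  proof -
    obtain F where F: "\<And>M. M \<in> F \<Longrightarrow> perfect_matching G M" "pairwise disjnt F" "card F = t"
      using t unfolding P_def by blast
    have "finite F"
      by (rule finite_subset[of _ "Pow (edges G)"])
        (use F(1) r_graphD(2)[OF G] in \<open>auto simp: perfect_matching_def\<close>)
    then obtain g where g: "bij_betw g {..<t} F"
      using F(3) by (metis atLeast0LessThan ex_bij_betw_nat_finite)
    \<comment> \<open>The value \<open>t\<close> marks the edges outside of all matchings.\<close>
    define c where "c e = (if \<exists>i<t. e \<in> g i then THE i. i < t \<and> e \<in> g i else t)" for e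
    have uniq: "i = j" if "e \<in> g i" "e \<in> g j" "i < t" "j < t" for e i j
    proof -
      have "g i \<in> F" "g j \<in> F" using g that by (auto simp: bij_betw_def)
      then have "g i = g j" using F(2) that unfolding pairwise_def disjnt_def by blast
      then show ?thesis using g that by (auto simp: bij_betw_def inj_on_def)
    qed
    have c: "c e = i \<longleftrightarrow> e \<in> g i" if "i < t" for e i
    proof
      assume "e \<in> g i"
      then have "(THE i. i < t \<and> e \<in> g i) = i" using uniq that by (intro the_equality) auto
      then show "c e = i" using \<open>e \<in> g i\<close> that unfolding c_def by auto
    next
      assume ci: "c e = i"
      have "\<exists>j<t. e \<in> g j"
      proof (rule ccontr)
        assume "\<not> ?thesis"
        then have "c e = t" unfolding c_def by (rule if_not_P)
        then show False using ci that by simp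
      qed
      then obtain j where j: "j < t" "e \<in> g j" by blast
      then have "(THE i. i < t \<and> e \<in> g i) = j" using uniq by (intro the_equality) auto
      then show "e \<in> g i" using ci j unfolding c_def by auto
    qed
    have "perfect_matching G (g i)" if "i < t" for i
      using F(1) g that by (auto simp: bij_betw_def)
    then have "packing G t c"
      using c unfolding packing_def perfect_matching_iff by simp
    then show ?thesis unfolding packs_def by blast
  qed
  have bound: "\<forall>y. P y \<longrightarrow> y \<le> r" using packs_if packs_le[OF G] by blast
  have "P 0" by (rule P_if) (simp add: packs_def packing_def)
  then have "P (pm_number G)" unfolding pm by (rule GreatestI_nat[of P 0 r]) (use bound in blast)
  then have max: "packs G (pm_number G)" by (rule packs_if)
  show ?thesis
  proof
    show "packs G t" if "t \<le> pm_number G" using max that by (rule packs_mono)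
    show "t \<le> pm_number G" if "packs G t"
    proof -
      have "y \<le> r" if "P y" for y using bound that by simp
      then show ?thesis unfolding pm by (rule Greatest_le_nat[of P t r, OF P_if[OF that]])
    qed
  qed
qed

lemma pm_number_eqI:
  assumes "r_graph r G" "packs G t" "\<not> packs G (Suc t)"
  shows "pm_number G = t"
  using le_pm_number_iff_packs[OF assms(1), of t] le_pm_number_iff_packs[OF assms(1), of "Suc t"] assms(2,3)
  by simp

lemma ex1_if_bij_betw:
  assumes "bij_betw f A B" "b \<in> B"
  shows "\<exists>!a. a \<in> A \<and> f a = b"
proof -
  obtain a where a: "a \<in> A" "f a = b" using assms by (auto simp: bij_betw_def)
  then have "a' = a" if "a' \<in> A" "f a' = b" for a'
    using that assms(1) by (auto simp: bij_betw_def inj_on_def)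
  then show ?thesis using a by blast
qed

text \<open>For \<open>t = r\<close> a packing is a proper edge coloring with \<open>r\<close> colors. In this form colors can be permuted
and colorings can be glued.\<close>

lemma packing_full_iff:
  assumes G: "r_graph r G"
  shows "packing G r c \<longleftrightarrow> (\<forall>v\<in>verts G. bij_betw c (boundary G {v}) {..<r})"
proof
  assume c: "packing G r c"
  show "\<forall>v\<in>verts G. bij_betw c (boundary G {v}) {..<r}"
  proof
    fix v assume v: "v \<in> verts G"
    have fin: "finite (boundary G {v})" using r_graphD(2)[OF G] by simp
    have sub: "{..<r} \<subseteq> c ` boundary G {v}" using packing_subset_image[OF c v] .
    have le: "card (c ` boundary G {v}) \<le> r" using card_image_le[OF fin] r_graphD(6)[OF G v] by simp
    have eq: "{..<r} = c ` boundary G {v}"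
      by (rule card_seteq) (use fin sub le in auto)
    then have "inj_on c (boundary G {v})"
      using fin r_graphD(6)[OF G v] by (intro eq_card_imp_inj_on) (auto simp flip: eq)
    then show "bij_betw c (boundary G {v}) {..<r}" using eq by (simp add: bij_betw_def)
  qed
next
  assume bij: "\<forall>v\<in>verts G. bij_betw c (boundary G {v}) {..<r}"
  show "packing G r c" unfolding packing_def
  proof (intro ballI allI impI)
    fix v i assume "v \<in> verts G" "i < r"
    then show "\<exists>!e. e \<in> boundary G {v} \<and> c e = i"
      using bij ex1_if_bij_betw[of c "boundary G {v}" "{..<r}" i] by blast
  qed
qed

text \<open>The edges outside of \<open>r - 1\<close> disjoint perfect matchings form another one.\<close>

lemma packs_full_if_packs_pred:
  assumes G: "r_graph (Suc k) G" and "packs G k"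
  shows "packs G (Suc k)"
proof -
  obtain c where c: "packing G k c" using assms(2) unfolding packs_def by blast
  \<comment> \<open>All colors from \<open>k\<close> on are merged into the single color \<open>k\<close>.\<close>
  define c' where "c' e = min (c e) k" for e
  have "packing G (Suc k) c'" unfolding packing_def
  proof (intro ballI allI impI)
    fix v i assume v: "v \<in> verts G" and i: "i < Suc k"
    show "\<exists>!e. e \<in> boundary G {v} \<and> c' e = i"
    proof (cases "i < k")
      case True
      then have "c' e = i \<longleftrightarrow> c e = i" for e unfolding c'_def by auto
      then show ?thesis using c v True by (simp add: packing_def)
    next
      case False
      let ?B = "boundary G {v}"
      let ?A = "{e \<in> ?B. c e < k}"
      have fin: "finite ?B" using r_graphD(2)[OF G] by simp
      have "bij_betw c ?A {..<k}"
      proof (rule bij_betwI')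
        show "c x = c y \<longleftrightarrow> x = y" if "x \<in> ?A" "y \<in> ?A" for x y
          using that c v unfolding packing_def by blast
        show "c x \<in> {..<k}" if "x \<in> ?A" for x using that by simp
        show "\<exists>x\<in>?A. y = c x" if "y \<in> {..<k}" for y
          using that c v unfolding packing_def by blast
      qed
      then have "card ?A = k" using bij_betw_same_card by fastforce
      then have "card (?B - ?A) = 1"
        using fin r_graphD(6)[OF G v] by (subst card_Diff_subset) (auto simp del: mem_boundary_singleton)
      then obtain e where "?B - ?A = {e}" by (rule card_1_singletonE)
      moreover have "c' e' = i \<longleftrightarrow> \<not> c e' < k" for e' using False i unfolding c'_def by auto
      ultimately have "e' \<in> ?B \<and> c' e' = i \<longleftrightarrow> e' \<in> {e}" for e' by blast
      then show ?thesis by simp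
    qed
  qed
  then show ?thesis unfolding packs_def by blast
qed

text \<open>The part of being an \<open>H\<close>-coloring that survives when the colors are half-edges, and that suffices to
pull back perfect matchings.\<close>

definition local_coloring :: "('v, 'e) mgraph \<Rightarrow> ('w, 'd) mgraph \<Rightarrow> ('d \<Rightarrow> 'e) \<Rightarrow> bool" where
  "local_coloring K G f \<longleftrightarrow>
     (\<forall>v\<in>verts G. \<exists>u\<in>verts K. bij_betw f (boundary G {v}) (boundary K {u}))"

lemma local_coloring_if_H_coloring:
  assumes "H_coloring H G f"
  shows "local_coloring H G f"
  unfolding local_coloring_def
proof
  fix v assume v: "v \<in> verts G"
  then obtain u where u: "u \<in> verts H" "f ` boundary G {v} = boundary H {u}"
    using assms unfolding H_coloring_def by blast
  have "inj_on f (boundary G {v})"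
  proof (rule inj_onI, rule ccontr)
    fix e1 e2 assume e: "e1 \<in> boundary G {v}" "e2 \<in> boundary G {v}" "f e1 = f e2" "e1 \<noteq> e2"
    then have "adjacent_edges G e1 e2" unfolding adjacent_edges_def by auto
    then show False using assms e(3) unfolding H_coloring_def by blast
  qed
  then show "\<exists>u\<in>verts H. bij_betw f (boundary G {v}) (boundary H {u})"
    using u by (auto simp: bij_betw_def)
qed

lemma packs_if_local_coloring:
  assumes "local_coloring K G f" "packs K t"
  shows "packs G t"
proof -
  obtain c where c: "packing K t c" using assms(2) unfolding packs_def by blast
  have "packing G t (c \<circ> f)" unfolding packing_def
  proof (intro ballI allI impI)
    fix v i assume v: "v \<in> verts G" and i: "i < t"
    obtain u where u: "u \<in> verts K" "bij_betw f (boundary G {v}) (boundary K {u})"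
      using assms(1) v unfolding local_coloring_def by blast
    have "\<exists>!e. e \<in> boundary K {u} \<and> c e = i" using c u i unfolding packing_def by blast
    then obtain d where d: "d \<in> boundary K {u}" "c d = i"
      and d_uniq: "\<And>d'. d' \<in> boundary K {u} \<Longrightarrow> c d' = i \<Longrightarrow> d' = d" by blast
    have "\<exists>!e. e \<in> boundary G {v} \<and> f e = d" using ex1_if_bij_betw[OF u(2) d(1)] .
    moreover have "(c \<circ> f) e = i \<longleftrightarrow> f e = d" if "e \<in> boundary G {v}" for e
    proof
      have "f e \<in> boundary K {u}" using bij_betwE[OF u(2)] that by blast
      then show "f e = d" if "(c \<circ> f) e = i" using that by (intro d_uniq) simp_all
      show "(c \<circ> f) e = i" if "f e = d" using that d(2) by simp
    qed
    ultimately show "\<exists>!e. e \<in> boundary G {v} \<and> (c \<circ> f) e = i" by (metis (no_types, lifting))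
  qed
  then show ?thesis unfolding packs_def by blast
qed

text \<open>Transports an arbitrary \<open>r\<close>-graph to the type over which minimality is defined.\<close>

lemma ex_nat_copy:
  fixes G :: "('v, 'e) mgraph"
  assumes G: "r_graph r G"
  obtains G' :: "(nat, nat) mgraph"
  where "r_graph r G'" "\<And>t. packs G' t \<longleftrightarrow> packs G t" "card (verts G') = card (verts G)"
proof -
  note GD = r_graphD[OF G]
  obtain g :: "'v \<Rightarrow> nat" where g: "inj_on g (verts G)"
    using finite_imp_inj_to_nat_seg[OF GD(1)] by (elim exE conjE) rule
  obtain h :: "'e \<Rightarrow> nat" where h: "inj_on h (edges G)"
    using finite_imp_inj_to_nat_seg[OF GD(2)] by (elim exE conjE) rule
  define G' where "G' = \<lparr>verts = g ` verts G, edges = h ` edges G,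
    ends = \<lambda>e. g ` ends G (inv_into (edges G) h e)\<rparr>"
  have V: "verts G' = g ` verts G" and E: "edges G' = h ` edges G"
    by (simp_all add: G'_def)
  have ends: "ends G' (h e) = g ` ends G e" if "e \<in> edges G" for e
    using that h by (simp add: G'_def)
  have bd: "boundary G' (g ` X) = h ` boundary G X" if X: "X \<subseteq> verts G" for X
  proof -
    have "card (g ` ends G e \<inter> g ` X) = card (ends G e \<inter> X)" if "e \<in> edges G" for e
    proof -
      have "g ` ends G e \<inter> g ` X = g ` (ends G e \<inter> X)"
        using g GD(4)[OF that] X by (simp add: inj_on_image_Int)
      then show ?thesis
        using g GD(4)[OF that] X by (metis Int_lower1 card_image inj_on_subset)
    qed
    then show ?thesis unfolding boundary_def E using ends by auto
  qed
  have card_bd: "card (boundary G' (g ` X)) = card (boundary G X)" if X: "X \<subseteq> verts G" for X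
    unfolding bd[OF X] using h by (intro card_image) (auto simp: boundary_def inj_on_def)
  have bd1: "boundary G' {g v} = h ` boundary G {v}" if "v \<in> verts G" for v
    using bd[of "{v}"] that by simp
  have hb: "bij_betw h (boundary G {v}) (boundary G' {g v})" if "v \<in> verts G" for v
    unfolding bd1[OF that] using h by (auto simp: bij_betw_def inj_on_def)
  have hb': "bij_betw (inv_into (edges G) h) (boundary G' {g v}) (boundary G {v})" if "v \<in> verts G" for v
    by (rule bij_betw_inv_into_subset[where A = "edges G" and A' = "edges G'"])
      (use h hb[OF that] that in \<open>auto simp: E bij_betw_def\<close>)
  have "r_graph r G'"
    unfolding r_graph_def regular_def multigraph_def
  proof (intro conjI ballI allI impI)
    show "finite (verts G')" "finite (edges G')" "verts G' \<noteq> {}" using GD(1-3) V E by simp_all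
    fix e assume "e \<in> edges G'"
    then obtain e0 where e0: "e0 \<in> edges G" "e = h e0" unfolding E by blast
    show "ends G' e \<subseteq> verts G'" using ends[OF e0(1)] e0(2) GD(4)[OF e0(1)] V by auto
    show "card (ends G' e) = 2"
      using e0 ends GD(5)[OF e0(1)] card_image[OF inj_on_subset[OF g GD(4)[OF e0(1)]]] by simp
  next
    fix v assume "v \<in> verts G'"
    then obtain v0 where "v0 \<in> verts G" "v = g v0" unfolding V by blast
    then show "card (boundary G' {v}) = r" using card_bd[of "{v0}"] GD(6) by simp
  next
    fix X assume "X \<subseteq> verts G'" "odd (card X)"
    then obtain X0 where X0: "X0 \<subseteq> verts G" "X = g ` X0" unfolding V by (auto simp: subset_image_iff)
    moreover have "card X = card X0" using X0 g by (metis card_image inj_on_subset)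
    ultimately show "r \<le> card (boundary G' X)" using card_bd[of X0] GD(7)[of X0] \<open>odd (card X)\<close> by simp
  qed
  moreover have "packs G' t \<longleftrightarrow> packs G t" for t
  proof
    show "packs G t" if "packs G' t"
      by (rule packs_if_local_coloring[OF _ that, of _ h]) (use hb V in \<open>auto simp: local_coloring_def\<close>)
    show "packs G' t" if "packs G t"
      by (rule packs_if_local_coloring[OF _ that, of _ "inv_into (edges G) h"])
        (use hb' V in \<open>auto simp: local_coloring_def\<close>)
  qed
  moreover have "card (verts G') = card (verts G)" using V g by (simp add: card_image)
  ultimately show thesis by (rule that)
qed

text \<open>Capping \<open>X\<close> and its complement contracts the other side of the cut to a vertex. In both contractions
the \<open>r\<close> edges of the cut are the edges at one vertex, hence carry each color once, and a permutation
of the colors makes the two colorings agree on them.\<close>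

lemma packs_full_if_tight_cut:
  assumes H: "r_graph r H" and X: "X \<subseteq> verts H"
    and tight: "card (boundary H X) = r"
    and z: "z1 \<notin> X" "z2 \<in> X"
    and H1: "r_graph r (cap (restrict_graph H X) z1)" "packs (cap (restrict_graph H X) z1) r"
    and H2: "r_graph r (cap (restrict_graph H (verts H - X)) z2)" "packs (cap (restrict_graph H (verts H - X)) z2) r"
  shows "packs H r"
proof -
  note HD = r_graphD[OF H]
  obtain c1 where "packing (cap (restrict_graph H X) z1) r c1"
    using H1(2) unfolding packs_def by blast
  then have c1: "\<forall>v\<in>insert z1 X. bij_betw c1 (boundary (cap (restrict_graph H X) z1) {v}) {..<r}"
    unfolding packing_full_iff[OF H1(1)] by simp
  obtain c2 where "packing (cap (restrict_graph H (verts H - X)) z2) r c2"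
    using H2(2) unfolding packs_def by blast
  then have c2: "\<forall>v\<in>insert z2 (verts H - X). bij_betw c2 (boundary (cap (restrict_graph H (verts H - X)) z2) {v}) {..<r}"
    unfolding packing_full_iff[OF H2(1)] by simp
  have compl: "boundary H (verts H - X) = boundary H X"
    by (rule boundary_Diff) (use HD in auto)
  have apex: "boundary (cap (restrict_graph H Y) z) {z} = boundary H Y" if "z \<notin> Y" for Y z
  proof -
    have "ends H e \<inter> Y \<noteq> {}" if "card (ends H e \<inter> Y) = 1" for e using that by auto
    then show ?thesis using \<open>z \<notin> Y\<close> unfolding boundary_def[of H] by (auto split: if_splits)
  qed
  have at_vertex: "boundary (cap (restrict_graph H Y) z) {v} = boundary H {v}" if "v \<in> Y" "z \<notin> Y" for Y z v
    using that boundary_cap[of z "{v}" "restrict_graph H Y"] boundary_restrict_graph[of "{v}" Y H] by auto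
  have c1b: "bij_betw c1 (boundary H X) {..<r}"
    using c1[rule_format, of z1] unfolding apex[OF z(1)] by simp
  have "z2 \<notin> verts H - X" using z by simp
  have c2b: "bij_betw c2 (boundary H X) {..<r}"
    using c2[rule_format, of z2] unfolding apex[OF \<open>z2 \<notin> verts H - X\<close>] compl by simp
  have c1v: "bij_betw c1 (boundary H {v}) {..<r}" if "v \<in> X" for v
    using c1[rule_format, of v] that unfolding at_vertex[OF that z(1)] by simp
  have c2v: "bij_betw c2 (boundary H {v}) {..<r}" if "v \<in> verts H - X" for v
    using c2[rule_format, of v] that unfolding at_vertex[OF that \<open>z2 \<notin> verts H - X\<close>] by simp
  \<comment> \<open>The permutation of colors that turns \<open>c2\<close> into \<open>c1\<close> on the cut.\<close>
  define s where "s = c1 \<circ> inv_into (boundary H X) c2"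
  have s: "bij_betw s {..<r} {..<r}"
    unfolding s_def using bij_betw_trans[OF bij_betw_inv_into[OF c2b] c1b] .
  have s_eq: "s (c2 e) = c1 e" if "e \<in> boundary H X" for e
    using that c2b unfolding s_def by (simp add: bij_betw_def inv_into_f_f)
  define c where "c e = (if ends H e \<inter> X \<noteq> {} then c1 e else s (c2 e))" for e
  have "bij_betw c (boundary H {v}) {..<r}" if v: "v \<in> verts H" for v
  proof (cases "v \<in> X")
    case True
    then have "c e = c1 e" if "e \<in> boundary H {v}" for e using that unfolding c_def by auto
    then show ?thesis using c1v[OF True] bij_betw_cong by blast
  next
    case False
    have "c e = (s \<circ> c2) e" if e: "e \<in> boundary H {v}" for e
    proof (cases "ends H e \<inter> X = {}")
      case True
      then show ?thesis unfolding c_def by simp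
    next
      case nonempty: False
      obtain p q where pq: "ends H e = {p, q}" "p \<noteq> q"
        using HD(5)[of e] e by (auto simp: card_2_iff)
      moreover have "v = p \<or> v = q" using e pq(1) by auto
      ultimately have "card (ends H e \<inter> X) = 1"
        using nonempty False unfolding pq(1) card_doubleton_Int_eq_1[OF pq(2)] by auto
      then have "e \<in> boundary H X" using e unfolding boundary_def[of H X] by simp
      then show ?thesis using s_eq nonempty unfolding c_def by simp
    qed
    moreover have "bij_betw (s \<circ> c2) (boundary H {v}) {..<r}"
      using bij_betw_trans[OF c2v s] v False by blast
    ultimately show ?thesis using bij_betw_cong by blast
  qed
  then show ?thesis unfolding packs_def packing_full_iff[OF H] by blast
qed

section \<open>Perfect matchings of r-graphs\<close>

text \<open>A perfect matching of the graph with adjacency \<open>R\<close> on \<open>A\<close>, as the involution that sends each vertex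
to its partner.\<close>

definition pairing :: "('v \<Rightarrow> 'v \<Rightarrow> bool) \<Rightarrow> 'v set \<Rightarrow> ('v \<Rightarrow> 'v) \<Rightarrow> bool" where
  "pairing R A m \<longleftrightarrow> (\<forall>v\<in>A. m v \<in> A \<and> m (m v) = v \<and> R v (m v))"

lemma pairingD:
  assumes "pairing R A m" "v \<in> A"
  shows "m v \<in> A" "m (m v) = v" "R v (m v)"
  using assms unfolding pairing_def by blast+

lemma pairing_insert_pair:
  assumes m: "pairing R A m" and ab: "a \<notin> A" "b \<notin> A" "a \<noteq> b" "R a b" "R b a"
  shows "pairing R (insert a (insert b A)) (m(a := b, b := a))"
  unfolding pairing_def
proof
  fix v assume v: "v \<in> insert a (insert b A)"
  show "(m(a := b, b := a)) v \<in> insert a (insert b A) \<and> (m(a := b, b := a)) ((m(a := b, b := a)) v) = v \<and>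
    R v ((m(a := b, b := a)) v)"
  proof (cases "v \<in> A")
    case True
    then have "m v \<in> A" "m (m v) = v" "R v (m v)" using m by (auto dest: pairingD)
    moreover from this have "m v \<noteq> a" "m v \<noteq> b" "v \<noteq> a" "v \<noteq> b" using True ab by auto
    ultimately show ?thesis by simp
  next
    case False
    then show ?thesis using v ab by auto
  qed
qed

lemma ex_pairing_Un:
  assumes m: "pairing R A m" and n: "pairing R B n" and disj: "A \<inter> B = {}"
  shows "\<exists>k. pairing R (A \<union> B) k"
proof (intro exI[of _ "\<lambda>v. if v \<in> A then m v else n v"], unfold pairing_def, intro ballI)
  fix v assume v: "v \<in> A \<union> B"
  let ?k = "\<lambda>v. if v \<in> A then m v else n v"
  show "?k v \<in> A \<union> B \<and> ?k (?k v) = v \<and> R v (?k v)"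
  proof (cases "v \<in> A")
    case True
    then show ?thesis using pairingD[OF m True] by simp
  next
    case False
    then have "v \<in> B" using v by blast
    note nv = pairingD[OF n this]
    then have "n v \<notin> A" using disj by blast
    then show ?thesis using nv False by simp
  qed
qed

lemma ex_pairing_Union:
  assumes "finite \<A>" and "\<And>A. A \<in> \<A> \<Longrightarrow> finite A \<and> even (card A) \<and> (\<exists>m. pairing R A m)"
    and "pairwise disjnt \<A>"
  shows "even (card (\<Union>\<A>)) \<and> (\<exists>m. pairing R (\<Union>\<A>) m)"
  using assms
proof (induction \<A> rule: finite_induct)
  case empty
  then show ?case by (simp add: pairing_def)
next
  case (insert A \<A>)
  have IH: "even (card (\<Union>\<A>)) \<and> (\<exists>m. pairing R (\<Union>\<A>) m)"
    using insert.prems by (intro insert.IH) (auto simp: pairwise_insert)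
  have A: "finite A" "even (card A)" "\<exists>m. pairing R A m" using insert.prems(1)[of A] by simp_all
  have disj: "A \<inter> \<Union>\<A> = {}"
    using insert.prems(2) insert.hyps(2) unfolding pairwise_def disjnt_def by auto
  have "finite (\<Union>\<A>)" using insert.hyps(1) insert.prems(1) by auto
  then have "even (card (\<Union>(insert A \<A>)))"
    using A(1,2) IH disj by (simp add: card_Un_disjoint)
  moreover have "\<exists>m. pairing R (\<Union>(insert A \<A>)) m"
    using A(3) IH ex_pairing_Un[OF _ _ disj] by (metis Union_insert)
  ultimately show ?case by blast
qed

lemma ex_pairing_clique:
  assumes "finite A" "even (card A)" "\<And>u v. u \<in> A \<Longrightarrow> v \<in> A \<Longrightarrow> u \<noteq> v \<Longrightarrow> R u v"
  shows "\<exists>m. pairing R A m"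
  using assms
proof (induction A rule: finite_psubset_induct)
  case (psubset A)
  show ?case
  proof (cases "A = {}")
    case True
    then show ?thesis by (simp add: pairing_def)
  next
    case False
    then have "2 \<le> card A" using psubset.hyps psubset.prems(1) by (metis card_0_eq dvd_imp_le not_gr_zero)
    then obtain P where P: "P \<subseteq> A" "card P = 2" by (rule obtain_subset_with_card_n)
    then obtain a b where ab: "a \<in> A" "b \<in> A" "a \<noteq> b" by (auto simp: card_2_iff)
    have "card (A - {a, b}) = card A - 2" using ab psubset.hyps by (simp add: card_Diff_subset)
    then have "even (card (A - {a, b}))" using psubset.prems(1) by simp
    moreover have "A - {a, b} \<subset> A" using ab by blast
    ultimately obtain m where "pairing R (A - {a, b}) m"
      using psubset.IH[of "A - {a, b}"] psubset.prems(2) by auto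
    then have "pairing R (insert a (insert b (A - {a, b}))) (m(a := b, b := a))"
      using ab psubset.prems(2) by (intro pairing_insert_pair) auto
    moreover have "insert a (insert b (A - {a, b})) = A" using ab by blast
    ultimately show ?thesis by metis
  qed
qed

text \<open>The alternating-path step in Lovasz's proof of Tutte's theorem. Here \<open>m\<close> is perfect but may use the
non-edge \<open>xz\<close>, while \<open>n\<close> leaves only \<open>y\<close> and \<open>u\<close> unmatched. If \<open>u\<close> is \<open>x\<close> or \<open>z\<close>, or is matched to \<open>y\<close>
by \<open>m\<close>, then \<open>u\<close> and \<open>y\<close> are adjacent and \<open>n\<close> can be completed. Otherwise \<open>m\<close> matches \<open>u\<close> by a proper
edge to some \<open>t\<close>; match \<open>u\<close> with \<open>t\<close> in \<open>n\<close> instead, which leaves the former partner of \<open>t\<close> unmatched.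
This increases the number of vertices on which \<open>n\<close> and \<open>m\<close> agree, so the process ends, and no
alternating path has to be followed.\<close>

lemma ex_pairing_by_exchange:
  assumes fin: "finite V" and sym: "\<And>u v. R u v \<Longrightarrow> R v u" and irr: "\<And>v. \<not> R v v"
    and y: "y \<in> V" "R y x" "R y z"
    and m: "pairing (\<lambda>u v. R u v \<or> {u, v} = {x, z}) V m"
    and u: "u \<in> V" "u \<noteq> y" and n: "pairing R (V - {y, u}) n"
  shows "\<exists>k. pairing R V k"
  using u n
proof (induction "card V - card {v \<in> V - {y, u}. n v = m v}" arbitrary: u n rule: less_induct)
  case (less u n)
  have close: ?thesis if "R y u"
  proof -
    have "insert y (insert u (V - {y, u})) = V" using less.prems y(1) by blast
    moreover have "pairing R (insert y (insert u (V - {y, u}))) (n(y := u, u := y))"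
      using less.prems that sym by (intro pairing_insert_pair) auto
    ultimately show ?thesis by metis
  qed
  show ?case
  proof (cases "u \<in> {x, z} \<or> m u = y")
    case True
    have "R y u"
    proof (cases "u \<in> {x, z}")
      case False
      then have "m u = y" "{u, m u} \<noteq> {x, z}" using True by auto
      then have "R u y" using pairingD(3)[OF m less.prems(1)] by auto
      then show ?thesis by (rule sym)
    qed (use y in auto)
    then show ?thesis by (rule close)
  next
    case False
    define t where "t = m u"
    define u' where "u' = n t"
    have t: "t \<in> V" "m t = u" "R u t" "t \<noteq> y"
      using pairingD[OF m less.prems(1)] False unfolding t_def by auto
    have "t \<noteq> u" using t(3) irr by auto
    then have tV: "t \<in> V - {y, u}" using t by simp
    have u': "u' \<in> V - {y, u}" "n u' = t" "R t u'"
      using pairingD[OF less.prems(3) tV] unfolding u'_def by auto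
    have "u' \<noteq> t" using u'(3) irr by auto
    define n' where "n' = n(u := t, t := u)"
    have n': "pairing R (V - {y, u'}) n'"
      unfolding pairing_def
    proof
      fix v assume v: "v \<in> V - {y, u'}"
      consider "v = u" | "v = t" | "v \<in> V - {y, u}" "v \<noteq> t" using v by blast
      then show "n' v \<in> V - {y, u'} \<and> n' (n' v) = v \<and> R v (n' v)"
      proof cases
        case 1
        then show ?thesis using t \<open>t \<noteq> u\<close> \<open>u' \<noteq> t\<close> unfolding n'_def by simp
      next
        case 2
        then show ?thesis using t less.prems u' \<open>t \<noteq> u\<close> sym unfolding n'_def by auto
      next
        case 3
        note nv = pairingD[OF less.prems(3) 3(1)]
        have "n v \<noteq> u'" using nv(2) u'(2) 3(2) by auto
        moreover have "n v \<noteq> t" using nv(2) v unfolding u'_def by auto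
        ultimately show ?thesis using nv 3 unfolding n'_def by auto
      qed
    qed
    let ?agree = "{v \<in> V - {y, u}. n v = m v}" and ?agree' = "{v \<in> V - {y, u'}. n' v = m v}"
    have "insert u ?agree \<subseteq> ?agree'"
    proof
      fix v assume v: "v \<in> insert u ?agree"
      show "v \<in> ?agree'"
      proof (cases "v = u")
        case True
        then show ?thesis using less.prems u' \<open>t \<noteq> u\<close> unfolding n'_def t_def by auto
      next
        case False
        then have v': "v \<in> V" "v \<noteq> y" "v \<noteq> u" "n v = m v" using v by auto
        have "v \<noteq> u'"
        proof
          assume "v = u'"
          then have "m v = t" using v'(4) u'(2) by simp
          then have "v = u" using pairingD(2)[OF m v'(1)] t(2) by simp
          then show False using v' by simp
        qed
        moreover have "v \<noteq> t" using v'(4) t(2) u'(1) unfolding u'_def by auto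
        ultimately show ?thesis using v' unfolding n'_def by simp
      qed
    qed
    then have "card (insert u ?agree) \<le> card ?agree'" using fin by (intro card_mono) auto
    moreover have "card (insert u ?agree) = Suc (card ?agree)" using fin by (subst card_insert_disjoint) auto
    moreover have "card ?agree' \<le> card V" using fin by (intro card_mono) auto
    ultimately have "card V - card ?agree' < card V - card ?agree" by linarith
    then show ?thesis using u' n' by (intro less.hyps) auto
  qed
qed

text \<open>The nontrivial direction of Tutte's theorem, following Lovasz. Add edges as long as no perfect matching
arises and let \<open>S\<close> be the set of vertices that are then adjacent to all others. Outside of \<open>S\<close> adjacency
is transitive by the exchange lemma, so the components there are cliques. Were there at most \<open>|S|\<close> odd
ones, each could take one vertex of \<open>S\<close> and a perfect matching would exist. Components of the enlarged
graph are closed under adjacency in the given one.\<close>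

lemma ex_pairing_or_barrier:
  assumes fin: "finite V" and even: "even (card V)"
    and sym: "\<And>u v. R u v \<Longrightarrow> R v u" and irr: "\<And>v. \<not> R v v"
    and none: "\<nexists>m. pairing R V m"
  obtains S \<O> where "S \<subseteq> V" "card S < card \<O>" "pairwise disjnt \<O>"
    "\<And>C. C \<in> \<O> \<Longrightarrow> C \<subseteq> V - S \<and> odd (card C)"
    "\<And>C u v. C \<in> \<O> \<Longrightarrow> u \<in> C \<Longrightarrow> v \<in> V - S \<Longrightarrow> R u v \<Longrightarrow> v \<in> C"
proof -
  define good where "good E \<longleftrightarrow> {(u, v) \<in> V \<times> V. R u v} \<subseteq> E \<and> E \<subseteq> V \<times> V \<and>
    (\<forall>u v. (u, v) \<in> E \<longrightarrow> (v, u) \<in> E) \<and> (\<forall>v. (v, v) \<notin> E) \<and> (\<nexists>m. pairing (\<lambda>u v. (u, v) \<in> E) V m)" for E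
  have "good {(u, v) \<in> V \<times> V. R u v}"
    using sym irr none unfolding good_def pairing_def by auto
  moreover have "\<forall>E. good E \<longrightarrow> card E < Suc (card (V \<times> V))"
    using card_mono[OF finite_SigmaI[OF fin fin]] unfolding good_def less_Suc_eq_le by blast
  ultimately obtain E where "good E" and E_max: "\<And>E'. good E' \<Longrightarrow> card E' \<le> card E"
    using ex_has_greatest_nat[of good _ card] by blast
  then have RE: "\<And>u v. u \<in> V \<Longrightarrow> v \<in> V \<Longrightarrow> R u v \<Longrightarrow> (u, v) \<in> E"
    and EV: "E \<subseteq> V \<times> V" and symE: "\<And>u v. (u, v) \<in> E \<Longrightarrow> (v, u) \<in> E"
    and irrE: "\<And>v. (v, v) \<notin> E" and noneE: "\<nexists>m. pairing (\<lambda>u v. (u, v) \<in> E) V m"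
    unfolding good_def by blast+
  have finE: "finite E" using EV fin by (meson finite_SigmaI finite_subset)
  \<comment> \<open>By maximality of \<open>E\<close>, each further edge creates a perfect matching.\<close>
  have saturated: "\<exists>m. pairing (\<lambda>u v. (u, v) \<in> E \<or> {u, v} = {x, z}) V m"
    if xz: "x \<in> V" "z \<in> V" "x \<noteq> z" "(x, z) \<notin> E" for x z
  proof (rule ccontr)
    assume no: "\<not> ?thesis"
    let ?E = "insert (x, z) (insert (z, x) E)"
    have eq: "(\<lambda>u v. (u, v) \<in> ?E) = (\<lambda>u v. (u, v) \<in> E \<or> {u, v} = {x, z})"
      by (auto simp: fun_eq_iff doubleton_eq_iff)
    have "good ?E"
      unfolding good_def eq using no RE EV symE irrE xz by auto
    then have "card ?E \<le> card E" by (rule E_max)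
    moreover have "card E < card ?E" using finE xz(4) by (intro psubset_card_mono) auto
    ultimately show False by simp
  qed
  define S where "S = {s \<in> V. \<forall>v\<in>V. v \<noteq> s \<longrightarrow> (s, v) \<in> E}"
  have transE: "(x, z) \<in> E" if xy: "(x, y) \<in> E" and yz: "(y, z) \<in> E" and yS: "y \<notin> S" and "x \<noteq> z" for x y z
  proof (rule ccontr)
    assume xz: "(x, z) \<notin> E"
    have V: "x \<in> V" "y \<in> V" "z \<in> V" using xy yz EV by auto
    obtain w where w: "w \<in> V" "w \<noteq> y" "(y, w) \<notin> E" using yS V(2) unfolding S_def by blast
    obtain m where m: "pairing (\<lambda>u v. (u, v) \<in> E \<or> {u, v} = {x, z}) V m"
      using saturated[OF V(1,3) \<open>x \<noteq> z\<close> xz] by blast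
    obtain n where n: "pairing (\<lambda>u v. (u, v) \<in> E \<or> {u, v} = {y, w}) V n"
      using saturated[OF V(2) w(1) w(2)[symmetric] w(3)] by blast
    have n_E: "(v, n v) \<in> E" if "v \<in> V" "{v, n v} \<noteq> {y, w}" for v
      using pairingD(3)[OF n that(1)] that(2) by blast
    have "\<exists>k. pairing (\<lambda>u v. (u, v) \<in> E) V k"
    proof (cases "n y = w")
      case False
      have "{v, n v} \<noteq> {y, w}" if "v \<in> V" for v
        using False pairingD(2)[OF n that] by (auto simp: doubleton_eq_iff)
      then have "pairing (\<lambda>u v. (u, v) \<in> E) V n"
        using n n_E unfolding pairing_def by blast
      then show ?thesis by blast
    next
      case True
      then have nw: "n w = y" using pairingD(2)[OF n V(2)] by simp
      have near: "pairing (\<lambda>u v. (u, v) \<in> E) (V - {y, w}) n"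
        unfolding pairing_def
      proof
        fix v assume v: "v \<in> V - {y, w}"
        then have vV: "v \<in> V" and "v \<noteq> y" "v \<noteq> w" by auto
        note nv = pairingD[OF n vV]
        have "n v \<noteq> y" "n v \<noteq> w" using nv(2) True nw \<open>v \<noteq> y\<close> \<open>v \<noteq> w\<close> by auto
        then show "n v \<in> V - {y, w} \<and> n (n v) = v \<and> (v, n v) \<in> E"
          using nv n_E[OF vV] \<open>v \<noteq> y\<close> \<open>v \<noteq> w\<close> by (auto simp: doubleton_eq_iff)
      qed
      show ?thesis
        by (rule ex_pairing_by_exchange[where R = "\<lambda>u v. (u, v) \<in> E", OF fin _ _ V(2) _ _ m w(1,2) near])
          (use symE irrE xy yz in auto)
    qed
    then show False using noneE by blast
  qed
  \<comment> \<open>The component of \<open>v\<close> outside of \<open>S\<close>.\<close>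
  define cl where "cl v = {u \<in> V - S. u = v \<or> (v, u) \<in> E}" for v
  have cl_eq: "cl u = cl v" if "u \<in> cl v" "v \<in> V - S" for u v
  proof -
    have "(u, w) \<in> E \<or> u = w \<longleftrightarrow> (v, w) \<in> E \<or> v = w" if "w \<in> V - S" for w
      using \<open>u \<in> cl v\<close> \<open>v \<in> V - S\<close> that symE transE unfolding cl_def by blast
    then show ?thesis unfolding cl_def by blast
  qed
  define \<C> where "\<C> = cl ` (V - S)"
  define \<O> where "\<O> = {C \<in> \<C>. odd (card C)}"
  have C_sub: "C \<subseteq> V - S" if "C \<in> \<C>" for C using that unfolding \<C>_def cl_def by auto
  have disj: "C \<inter> D = {}" if C: "C \<in> \<C>" and D: "D \<in> \<C>" and "C \<noteq> D" for C D
  proof (rule ccontr)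
    assume "C \<inter> D \<noteq> {}"
    then obtain u where u: "u \<in> C" "u \<in> D" by blast
    obtain v w where "C = cl v" "D = cl w" "v \<in> V - S" "w \<in> V - S" using C D unfolding \<C>_def by blast
    then have "cl u = C" "cl u = D" using cl_eq[of u v] cl_eq[of u w] u by blast+
    then show False using \<open>C \<noteq> D\<close> by simp
  qed
  have C_clique: "(u, v) \<in> E" if C: "C \<in> \<C>" and uv: "u \<in> C" "v \<in> C" "u \<noteq> v" for C u v
  proof -
    obtain w where w: "C = cl w" "w \<in> V - S" using C unfolding \<C>_def by blast
    then have "cl u = C" using cl_eq[of u w] uv(1) by blast
    then show ?thesis using uv unfolding cl_def by auto
  qed
  have fin_C: "finite \<C>" using fin unfolding \<C>_def by simp
  have "card S < card \<O>"
  proof (rule ccontr)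
    assume "\<not> card S < card \<O>"
    then have "card \<O> \<le> card S" by simp
    moreover have "finite S" "finite \<O>" using fin fin_C unfolding S_def \<O>_def by simp_all
    ultimately have "\<exists>g. g ` \<O> \<subseteq> S \<and> inj_on g \<O>" by (intro card_le_inj)
    then obtain g where g: "g ` \<O> \<subseteq> S" "inj_on g \<O>" by blast
    \<comment> \<open>Odd components are completed to even cliques by a vertex of \<open>S\<close>; the vertices that remain lie
        in \<open>S\<close> and form an even clique too.\<close>
    define piece where "piece C = (if odd (card C) then insert (g C) C else C)" for C
    have SV: "S \<subseteq> V" unfolding S_def by blast
    have gS: "g C \<in> S" if "C \<in> \<C>" "odd (card C)" for C using that g(1) unfolding \<O>_def by blast
    have piece: "finite (piece C) \<and> even (card (piece C)) \<and> (\<exists>m. pairing (\<lambda>u v. (u, v) \<in> E) (piece C) m)"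
      if C: "C \<in> \<C>" for C
    proof -
      have finC: "finite C" using C_sub[OF C] fin by (meson finite_Diff finite_subset)
      have ev: "even (card (piece C))"
      proof (cases "odd (card C)")
        case True
        then have "g C \<notin> C" using gS[OF C] C_sub[OF C] by blast
        then show ?thesis using finC True unfolding piece_def by simp
      qed (simp add: piece_def)
      have finp: "finite (piece C)" using finC unfolding piece_def by simp
      have "(u, v) \<in> E" if u: "u \<in> piece C" and v: "v \<in> piece C" and "u \<noteq> v" for u v
      proof -
        have dich: "t \<in> C \<or> t \<in> S" if "t \<in> piece C" for t
          using that gS[OF C] unfolding piece_def by (auto split: if_splits)
        have inV: "u \<in> V" "v \<in> V" using dich[OF u] dich[OF v] C_sub[OF C] SV by auto
        have "(u, v) \<in> E" if "u \<in> S" using that inV \<open>u \<noteq> v\<close> unfolding S_def by auto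
        moreover have "(u, v) \<in> E" if "v \<in> S" using that inV \<open>u \<noteq> v\<close> symE unfolding S_def by auto
        moreover have "(u, v) \<in> E" if "u \<in> C" "v \<in> C" using C_clique[OF C that \<open>u \<noteq> v\<close>] .
        ultimately show ?thesis using dich[OF u] dich[OF v] by blast
      qed
      then have "\<exists>m. pairing (\<lambda>u v. (u, v) \<in> E) (piece C) m"
        using finp ev by (intro ex_pairing_clique) auto
      then show ?thesis using finp ev by blast
    qed
    have "piece C \<inter> piece D = {}" if C: "C \<in> \<C>" and D: "D \<in> \<C>" and "C \<noteq> D" for C D
    proof -
      have "g C \<noteq> g D" if "odd (card C)" "odd (card D)"
        using g(2) that C D \<open>C \<noteq> D\<close> unfolding \<O>_def inj_on_def by auto
      then show ?thesis
        using disj[OF that] gS[OF C] gS[OF D] C_sub[OF C] C_sub[OF D] unfolding piece_def by auto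
    qed
    then have "pairwise disjnt (piece ` \<C>)"
      by (intro pairwise_imageI) (simp add: disjnt_def)
    then have U: "even (card (\<Union>(piece ` \<C>)))" "\<exists>m. pairing (\<lambda>u v. (u, v) \<in> E) (\<Union>(piece ` \<C>)) m"
      using ex_pairing_Union[of "piece ` \<C>" "\<lambda>u v. (u, v) \<in> E"] fin_C piece by auto
    let ?U = "\<Union>(piece ` \<C>)"
    have U_sub: "?U \<subseteq> V" using C_sub gS SV unfolding piece_def by (auto split: if_splits)
    have "v \<in> ?U" if "v \<in> V - S" for v
    proof -
      have "v \<in> piece (cl v)" using that unfolding piece_def cl_def by auto
      then show ?thesis using that unfolding \<C>_def by blast
    qed
    then have rest: "V - ?U \<subseteq> S" by blast
    have "finite ?U" using U_sub fin by (rule finite_subset)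
    then have "card (V - ?U) = card V - card ?U" "card ?U \<le> card V"
      using U_sub fin by (simp_all add: card_Diff_subset card_mono)
    then have "even (card (V - ?U))" using even U(1) by simp
    then have "\<exists>m. pairing (\<lambda>u v. (u, v) \<in> E) (V - ?U) m"
      using fin rest by (intro ex_pairing_clique) (auto simp: S_def)
    then have "\<exists>m. pairing (\<lambda>u v. (u, v) \<in> E) (?U \<union> (V - ?U)) m"
      using U(2) ex_pairing_Un[where A = ?U and B = "V - ?U" and R = "\<lambda>u v. (u, v) \<in> E"] by blast
    moreover have "?U \<union> (V - ?U) = V" using U_sub by blast
    ultimately show False using noneE by simp
  qed
  moreover have "pairwise disjnt \<O>" using disj unfolding \<O>_def pairwise_def disjnt_def by blast
  moreover have "C \<subseteq> V - S \<and> odd (card C)" if "C \<in> \<O>" for C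
    using that C_sub unfolding \<O>_def by blast
  moreover have "v \<in> C" if C: "C \<in> \<O>" and uv: "u \<in> C" "v \<in> V - S" "R u v" for C u v
  proof -
    obtain w where w: "C = cl w" "w \<in> V - S" using C unfolding \<O>_def \<C>_def by blast
    then have "cl u = C" using cl_eq[of u w] uv(1) by blast
    moreover have "u \<in> V" using C C_sub uv(1) unfolding \<O>_def by blast
    then have "(u, v) \<in> E" using RE uv by blast
    ultimately show ?thesis using uv(2) unfolding cl_def by blast
  qed
  moreover have "S \<subseteq> V" unfolding S_def by blast
  ultimately show thesis using that by blast
qed

text \<open>At least \<open>r\<close> edges leave each odd component, all of them end in the barrier \<open>S\<close>, and \<open>S\<close> can absorb at
most \<open>r |S|\<close> edges. So there are at most \<open>|S|\<close> odd components.\<close>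

lemma packs_one_if_r_graph:
  assumes G: "r_graph r G" and r: "r > 0"
  shows "packs G 1"
proof -
  note GD = r_graphD[OF G]
  define R where "R u v \<longleftrightarrow> (\<exists>e\<in>edges G. ends G e = {u, v})" for u v
  have sym: "R v u" if "R u v" for u v using that unfolding R_def by (simp add: insert_commute)
  have irr: "\<not> R v v" for v using GD(5) unfolding R_def by force
  have "\<exists>m. pairing R (verts G) m"
  proof (rule ccontr)
    assume none: "\<nexists>m. pairing R (verts G) m"
    obtain S \<O> where S: "S \<subseteq> verts G" "card S < card \<O>" "pairwise disjnt \<O>"
      and O: "\<And>C. C \<in> \<O> \<Longrightarrow> C \<subseteq> verts G - S \<and> odd (card C)"
      and closed: "\<And>C u v. C \<in> \<O> \<Longrightarrow> u \<in> C \<Longrightarrow> v \<in> verts G - S \<Longrightarrow> R u v \<Longrightarrow> v \<in> C"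
      using ex_pairing_or_barrier[OF GD(1) even_card_verts[OF G r] sym irr none] by metis
    have finO: "finite \<O>"
      by (rule finite_subset[of _ "Pow (verts G)"]) (use O GD(1) in auto)
    have finS: "finite S" using S(1) GD(1) by (rule finite_subset)
    have cross: "\<exists>u v. ends G e = {u, v} \<and> u \<in> C \<and> v \<in> S" if C: "C \<in> \<O>" and e: "e \<in> boundary G C" for C e
    proof -
      have eE: "e \<in> edges G" and one: "card (ends G e \<inter> C) = 1" using e by (auto simp: boundary_def)
      obtain p q where pq: "ends G e = {p, q}" "p \<noteq> q" using GD(5)[OF eE] by (auto simp: card_2_iff)
      have cut: "p \<in> C \<longleftrightarrow> q \<notin> C" using one unfolding pq(1) card_doubleton_Int_eq_1[OF pq(2)] .
      have inV: "p \<in> verts G" "q \<in> verts G" using GD(4)[OF eE] pq by auto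
      have R: "R p q" "R q p" using eE pq(1) sym unfolding R_def by blast+
      show ?thesis
      proof (cases "p \<in> C")
        case True
        then have "q \<in> S" using closed[OF C True _ R(1)] cut inV by blast
        then show ?thesis using True pq by blast
      next
        case False
        then have "q \<in> C" using cut by blast
        then have "p \<in> S" using closed[OF C _ _ R(2)] False inV by blast
        then show ?thesis using \<open>q \<in> C\<close> pq(1) by (metis insert_commute)
      qed
    qed
    have disj: "boundary G C \<inter> boundary G D = {}" if CD: "C \<in> \<O>" "D \<in> \<O>" "C \<noteq> D" for C D
    proof (rule ccontr)
      assume "boundary G C \<inter> boundary G D \<noteq> {}"
      then obtain e where e: "e \<in> boundary G C" "e \<in> boundary G D" by blast
      obtain u v where uv: "ends G e = {u, v}" "u \<in> C" "v \<in> S" using cross[OF CD(1) e(1)] by blast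
      obtain u' v' where uv': "ends G e = {u', v'}" "u' \<in> D" "v' \<in> S" using cross[OF CD(2) e(2)] by blast
      have "u \<notin> S" "u' \<notin> S" using O CD uv uv' by blast+
      then have "u = u'" using uv uv' by (auto simp: doubleton_eq_iff)
      then show False using S(3) CD uv uv' unfolding pairwise_def disjnt_def by blast
    qed
    have "r * card \<O> = (\<Sum>C\<in>\<O>. r)" by simp
    also have "\<dots> \<le> (\<Sum>C\<in>\<O>. card (boundary G C))"
      using O GD(7) by (intro sum_mono) blast
    also have "\<dots> = card (\<Union>C\<in>\<O>. boundary G C)"
      using finO GD(2) disj by (intro card_UN_disjoint[symmetric]) auto
    also have "\<dots> \<le> card (\<Union>s\<in>S. boundary G {s})"
    proof (rule card_mono)
      show "finite (\<Union>s\<in>S. boundary G {s})" using finS GD(2) by simp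
      show "(\<Union>C\<in>\<O>. boundary G C) \<subseteq> (\<Union>s\<in>S. boundary G {s})"
      proof
        fix e assume "e \<in> (\<Union>C\<in>\<O>. boundary G C)"
        then obtain C where C: "C \<in> \<O>" "e \<in> boundary G C" by blast
        obtain u v where "ends G e = {u, v}" "v \<in> S" using cross[OF C] by blast
        moreover have "e \<in> edges G" using C(2) by (simp add: boundary_def)
        ultimately show "e \<in> (\<Union>s\<in>S. boundary G {s})" by auto
      qed
    qed
    also have "\<dots> \<le> (\<Sum>s\<in>S. card (boundary G {s}))" by (rule card_UN_le[OF finS])
    also have "\<dots> = r * card S" using S(1) GD(6) by (simp add: subset_iff)
    finally show False using S(2) r by simp
  qed
  then obtain m where m: "pairing R (verts G) m" by blast
  define g where "g P = (SOME e. e \<in> edges G \<and> ends G e = P)" for P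
  have g: "g {v, m v} \<in> edges G" "ends G (g {v, m v}) = {v, m v}" if "v \<in> verts G" for v
  proof -
    have "\<exists>e. e \<in> edges G \<and> ends G e = {v, m v}" using pairingD(3)[OF m that] unfolding R_def by blast
    from someI_ex[OF this] show "g {v, m v} \<in> edges G" "ends G (g {v, m v}) = {v, m v}"
      unfolding g_def by blast+
  qed
  define M where "M = (\<lambda>v. g {v, m v}) ` verts G"
  have "packing G 1 (\<lambda>e. if e \<in> M then 0 else 1)"
    unfolding packing_def
  proof (intro ballI allI impI)
    fix v i assume v: "v \<in> verts G" and i: "i < (1::nat)"
    have uniq: "e = g {v, m v}" if e: "e \<in> M" "v \<in> ends G e" for e
    proof -
      obtain u where u: "u \<in> verts G" "e = g {u, m u}" using e(1) unfolding M_def by blast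
      then have "v \<in> {u, m u}" using e(2) g(2)[OF u(1)] u(2) by simp
      then have "{u, m u} = {v, m v}" using pairingD(2)[OF m u(1)] by auto
      then show ?thesis using u(2) by simp
    qed
    show "\<exists>!e. e \<in> boundary G {v} \<and> (if e \<in> M then 0 else 1) = i"
    proof (rule ex1I[of _ "g {v, m v}"])
      have "g {v, m v} \<in> M" using v unfolding M_def by blast
      then show "g {v, m v} \<in> boundary G {v} \<and> (if g {v, m v} \<in> M then 0 else 1) = i"
        using g[OF v] i by simp
      fix e assume e: "e \<in> boundary G {v} \<and> (if e \<in> M then 0 else 1) = i"
      then have "e \<in> M" using i by (cases "e \<in> M") simp_all
      then show "e = g {v, m v}" using e by (intro uniq) simp_all
    qed
  qed
  then show ?thesis unfolding packs_def by blast
qed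

section \<open>Small r-graphs without r disjoint perfect matchings\<close>

text \<open>Meant for edges \<open>e1 = ac\<close> and \<open>e2 = bd\<close>, which become \<open>ab\<close> and \<open>cd\<close>.\<close>

definition switch :: "('v, 'e) mgraph \<Rightarrow> 'e \<Rightarrow> 'e \<Rightarrow> 'v \<Rightarrow> 'v \<Rightarrow> 'v \<Rightarrow> 'v \<Rightarrow> ('v, 'e) mgraph" where
  "switch H e1 e2 a b c d = H\<lparr>ends := (ends H)(e1 := {a, b}, e2 := {c, d})\<rparr>"

lemma switch_simps [simp]:
  "verts (switch H e1 e2 a b c d) = verts H"
  "edges (switch H e1 e2 a b c d) = edges H"
  "ends (switch H e1 e2 a b c d) = (ends H)(e1 := {a, b}, e2 := {c, d})"
  by (simp_all add: switch_def)

locale switchable =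
  fixes H :: "('v, 'e) mgraph" and r e1 e2 a b c d
  assumes H: "r_graph r H"
    and e1: "e1 \<in> edges H" "ends H e1 = {a, c}"
    and e2: "e2 \<in> edges H" "ends H e2 = {b, d}"
    and neq: "a \<noteq> b" "a \<noteq> c" "a \<noteq> d" "b \<noteq> c" "b \<noteq> d" "c \<noteq> d"
begin

abbreviation "H' \<equiv> switch H e1 e2 a b c d"

lemma e1_neq_e2: "e1 \<noteq> e2"
  using e1 e2 neq by (auto simp: doubleton_eq_iff)

lemma mem_boundary_switch:
  "e \<in> boundary H' {v} \<longleftrightarrow>
     (if e = e1 then v = a \<or> v = b else if e = e2 then v = c \<or> v = d else e \<in> boundary H {v})"
  using e1(1) e2(1) e1_neq_e2 by simp

lemma mem_boundary_e1_e2: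
  "e1 \<in> boundary H {v} \<longleftrightarrow> v = a \<or> v = c" "e2 \<in> boundary H {v} \<longleftrightarrow> v = b \<or> v = d"
  using e1 e2 by simp_all

lemma card_boundary_vertex_switch:
  assumes v: "v \<in> verts H"
  shows "card (boundary H' {v}) = r"
proof -
  have fin: "finite (boundary H {v})" using r_graphD(2)[OF H] by simp
  have card: "card (boundary H {v}) = r" using r_graphD(6)[OF H v] .
  consider "v = b" | "v = c" | "v \<noteq> b" "v \<noteq> c" by blast
  then show ?thesis
  proof cases
    case 1
    have "boundary H' {v} = insert e1 (boundary H {v} - {e2})"
      using 1 neq e1_neq_e2
      by (auto simp: set_eq_iff mem_boundary_switch mem_boundary_e1_e2 simp del: mem_boundary_singleton)
    moreover have "e2 \<in> boundary H {v}" "e1 \<notin> boundary H {v}"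
      unfolding mem_boundary_e1_e2 using 1 neq by auto
    ultimately show ?thesis using fin card card_Suc_Diff1[of "boundary H {v}" e2]
      by (simp del: mem_boundary_singleton)
  next
    case 2
    have "boundary H' {v} = insert e2 (boundary H {v} - {e1})"
      using 2 neq e1_neq_e2
      by (auto simp: set_eq_iff mem_boundary_switch mem_boundary_e1_e2 simp del: mem_boundary_singleton)
    moreover have "e1 \<in> boundary H {v}" "e2 \<notin> boundary H {v}"
      unfolding mem_boundary_e1_e2 using 2 neq by auto
    ultimately show ?thesis using fin card card_Suc_Diff1[of "boundary H {v}" e1]
      by (simp del: mem_boundary_singleton)
  next
    case 3
    then have "boundary H' {v} = boundary H {v}"
      using neq e1_neq_e2
      by (auto simp: set_eq_iff mem_boundary_switch mem_boundary_e1_e2 simp del: mem_boundary_singleton)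
    then show ?thesis using card by simp
  qed
qed

text \<open>A switch preserves degrees and removes at most two edges from a cut. Odd cuts with a single vertex on
one side have exactly \<open>r\<close> edges; the other ones have two edges to spare.\<close>

lemma r_graph_switch:
  assumes r: "r > 0"
    and cuts: "\<And>X. X \<subseteq> verts H \<Longrightarrow> odd (card X) \<Longrightarrow> 1 < card X \<Longrightarrow> 1 < card (verts H - X) \<Longrightarrow>
      r + 2 \<le> card (boundary H X)"
  shows "r_graph r H'"
proof -
  note HD = r_graphD[OF H]
  have ends: "ends H' e \<subseteq> verts H'" "card (ends H' e) = 2" if "e \<in> edges H'" for e
  proof -
    have "a \<in> verts H" "b \<in> verts H" "c \<in> verts H" "d \<in> verts H" using HD(4) e1 e2 by auto
    then show "ends H' e \<subseteq> verts H'" "card (ends H' e) = 2" using HD(4,5)[of e] that neq by auto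
  qed
  have "r \<le> card (boundary H' X)" if X: "X \<subseteq> verts H" "odd (card X)" for X
  proof -
    have finX: "finite X" using X(1) HD(1) by (rule finite_subset)
    have "card (verts H - X) = card (verts H) - card X" "card X \<le> card (verts H)"
      using X(1) finX HD(1) by (simp_all add: card_Diff_subset card_mono)
    then have odd: "odd (card (verts H - X))" using even_card_verts[OF H r] X(2) by simp
    have pos: "0 < card X" "0 < card (verts H - X)" using odd X(2) odd_pos by blast+
    then consider "card X = 1" | "card (verts H - X) = 1" | "1 < card X" "1 < card (verts H - X)"
      by linarith
    then show ?thesis
    proof cases
      case 1
      then obtain v where "X = {v}" by (rule card_1_singletonE)
      then show ?thesis using card_boundary_vertex_switch[of v] X by simp
    next
      case 2
      then obtain v where v: "verts H - X = {v}" by (rule card_1_singletonE)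
      have "boundary H' (verts H' - X) = boundary H' X"
        by (rule boundary_Diff) (use ends in blast)
      then show ?thesis using card_boundary_vertex_switch[of v] v by auto
    next
      case 3
      have "boundary H X \<subseteq> boundary H' X \<union> {e1, e2}" unfolding boundary_def by auto
      then have "card (boundary H X) \<le> card (boundary H' X \<union> {e1, e2})"
        using HD(2) by (intro card_mono) auto
      also have "\<dots> \<le> card (boundary H' X) + card {e1, e2}" by (rule card_Un_le)
      also have "\<dots> = card (boundary H' X) + 2" using e1_neq_e2 by simp
      finally show ?thesis using cuts[OF X 3] by simp
    qed
  qed
  then show ?thesis
    unfolding r_graph_def regular_def multigraph_def
    using HD(1-3) ends card_boundary_vertex_switch by simp
qed

text \<open>Those of the \<open>r\<close> matchings that contain neither of the two new edges are perfect matchings of the original graph,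
and at most two of the \<open>r\<close> contain one.\<close>

lemma packs_if_packs_switch:
  assumes "packs H' r"
  shows "packs H (r - 2)"
proof -
  obtain col where col: "packing H' r col" using assms unfolding packs_def by blast
  \<comment> \<open>The colors of matchings that survive in \<open>H\<close>; \<open>r - 2\<close> of them are renamed to \<open>{..<r - 2}\<close>.\<close>
  define I where "I = {..<r} - {col e1, col e2}"
  have "card {..<r} - card {col e1, col e2} \<le> card I"
    unfolding I_def by (rule diff_card_le_card_Diff) simp
  moreover have "card {col e1, col e2} \<le> 2" by (simp add: card_insert_if)
  ultimately have "r - 2 \<le> card I" by simp
  then obtain J where J: "J \<subseteq> I" "card J = r - 2" "finite J" by (rule obtain_subset_with_card_n)
  then obtain g where g: "bij_betw g J {..<r - 2}"
    using ex_bij_betw_finite_nat[of J] by (auto simp: atLeast0LessThan)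
  define col' where "col' e = (if col e \<in> J then g (col e) else r)" for e
  have "packing H (r - 2) col'" unfolding packing_def
  proof (intro ballI allI impI)
    fix v i assume v: "v \<in> verts H" and i: "i < r - 2"
    obtain j where j: "j \<in> J" "g j = i" using bij_betw_imp_surj_on[OF g] i by (metis imageE lessThan_iff)
    have col': "col' e = i \<longleftrightarrow> col e = j" for e
      using j i g unfolding col'_def bij_betw_def inj_on_def by auto
    have "e \<in> boundary H {v} \<and> col e = j \<longleftrightarrow> e \<in> boundary H' {v} \<and> col e = j" for e
    proof (cases "e = e1 \<or> e = e2")
      case True
      then have "col e \<noteq> j" using j(1) J(1) unfolding I_def by blast
      then show ?thesis by blast
    qed (simp only: mem_boundary_switch, simp)
    moreover have "j < r" using j(1) J(1) unfolding I_def by blast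
    then have "\<exists>!e. e \<in> boundary H' {v} \<and> col e = j"
      using col v unfolding packing_def switch_simps by blast
    ultimately show "\<exists>!e. e \<in> boundary H {v} \<and> col' e = i" unfolding col' by simp
  qed
  then show ?thesis unfolding packs_def by blast
qed

end

definition parallel_edges :: "('v, 'e) mgraph \<Rightarrow> 'v \<Rightarrow> 'v \<Rightarrow> 'e set" where
  "parallel_edges H a b = {e \<in> edges H. ends H e = {a, b}}"

lemma parallel_edges_subset_boundary:
  "parallel_edges H a b \<subseteq> boundary H {a}" "parallel_edges H a b \<subseteq> boundary H {b}"
  by (auto simp: parallel_edges_def)

lemma ex_other_end:
  assumes "r_graph r H" "e \<in> boundary H {v}"
  obtains w where "ends H e = {v, w}" "w \<noteq> v" "w \<in> verts H"
proof -
  have e: "e \<in> edges H" "v \<in> ends H e" using assms(2) by simp_all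
  then obtain p q where "ends H e = {p, q}" "p \<noteq> q"
    using r_graphD(5)[OF assms(1)] by (metis card_2_iff)
  then show thesis using e that r_graphD(4)[OF assms(1) e(1)] by (cases "v = p") auto
qed

text \<open>If no switch is possible, there is a vertex \<open>c\<close> such that \<open>a\<close> and \<open>b\<close> have all their neighbours in
\<open>{a, b, c}\<close>. Then the cut of this odd set consists of edges at \<open>c\<close>, but not of all of them.\<close>

lemma ex_switchable:
  assumes H: "r_graph r H" and ab: "a \<in> verts H" "b \<in> verts H" "a \<noteq> b"
    and lt: "card (parallel_edges H a b) < r"
  obtains e1 e2 c d where "switchable H r e1 e2 a b c d"
proof -
  note HD = r_graphD[OF H]
  have ex: "\<exists>e. e \<in> boundary H {v} - parallel_edges H a b" if "v \<in> {a, b}" for v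
  proof (rule ccontr)
    assume "\<not> ?thesis"
    then have "boundary H {v} \<subseteq> parallel_edges H a b" by blast
    moreover have "finite (parallel_edges H a b)" using HD(2) by (simp add: parallel_edges_def)
    ultimately have "card (boundary H {v}) \<le> card (parallel_edges H a b)" by (intro card_mono)
    then show False using lt HD(6)[of v] ab that by auto
  qed
  have other: "\<exists>w. ends H e = {v, w} \<and> w \<noteq> a \<and> w \<noteq> b \<and> w \<in> verts H"
    if e: "e \<in> boundary H {v} - parallel_edges H a b" and v: "v \<in> {a, b}" for e v
  proof -
    obtain w where w: "ends H e = {v, w}" "w \<noteq> v" "w \<in> verts H"
      by (rule ex_other_end[OF H, of e v]) (use e in blast)
    moreover have "ends H e \<noteq> {a, b}" using e by (auto simp: parallel_edges_def)
    ultimately show ?thesis using v by (intro exI[of _ w]) auto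
  qed
  obtain e1 where e1: "e1 \<in> boundary H {a} - parallel_edges H a b" using ex[of a] by blast
  then obtain c where c: "ends H e1 = {a, c}" "c \<noteq> a" "c \<noteq> b" "c \<in> verts H" using other[of e1 a] by blast
  have "\<exists>e2 d. e2 \<in> edges H \<and> ends H e2 = {b, d} \<and> d \<noteq> a \<and> d \<noteq> b \<and> d \<noteq> c \<or>
      e2 \<in> edges H \<and> ends H e2 = {a, d} \<and> d \<noteq> a \<and> d \<noteq> b \<and> d \<noteq> c"
  proof (rule ccontr)
    assume contra: "\<not> ?thesis"
    have to_c: "ends H e = {v, c}" if "e \<in> boundary H {v} - parallel_edges H a b" "v \<in> {a, b}" for e v
      using other[OF that] contra that by auto
    let ?X = "{a, b, c}"
    have "boundary H ?X \<subseteq> boundary H {c} - {e1}"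
    proof
      fix e assume e: "e \<in> boundary H ?X"
      then have eE: "e \<in> edges H" and one: "card (ends H e \<inter> ?X) = 1" by (auto simp: boundary_def)
      have *: "\<not> {p, q} \<subseteq> ends H e" if "p \<in> ?X" "q \<in> ?X" "p \<noteq> q" for p q
      proof
        assume "{p, q} \<subseteq> ends H e"
        then have "{p, q} \<subseteq> ends H e \<inter> ?X" using that by auto
        then have "card {p, q} \<le> card (ends H e \<inter> ?X)" by (intro card_mono) auto
        then show False using one that(3) by simp
      qed
      have notab: "e \<notin> parallel_edges H a b" using *[of a b] ab(3) by (auto simp: parallel_edges_def)
      have "a \<notin> ends H e" using to_c[of e a] *[of a c] notab c(2) eE by auto
      moreover have "b \<notin> ends H e" using to_c[of e b] *[of b c] notab c(3) eE by auto
      moreover have "ends H e \<inter> ?X \<noteq> {}"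
        using one card.empty zero_neq_one by metis
      ultimately show "e \<in> boundary H {c} - {e1}" using eE c(1) by auto
    qed
    then have "card (boundary H ?X) \<le> card (boundary H {c} - {e1})"
      using HD(2) by (intro card_mono) auto
    also have "\<dots> < card (boundary H {c})"
      using HD(2) e1 c by (intro psubset_card_mono) auto
    also have "\<dots> = r" using HD(6) c(4) by simp
    finally have "card (boundary H ?X) < r" .
    moreover have "odd (card ?X)" using ab c by simp
    ultimately show False using HD(7)[of ?X] ab c by simp
  qed
  then obtain e d where d: "e \<in> edges H" "d \<noteq> a" "d \<noteq> b" "d \<noteq> c" and
    e: "ends H e = {b, d} \<or> ends H e = {a, d}" by blast
  \<comment> \<open>The edge \<open>e\<close> avoids \<open>c\<close>. If it starts at \<open>b\<close>, it is switched with \<open>e1\<close>. If it starts at \<open>a\<close>, any edge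
      \<open>e3\<close> from \<open>b\<close> to a vertex other than \<open>a\<close> has a partner: \<open>e\<close> if it ends in \<open>c\<close>, and \<open>e1\<close> otherwise.\<close>
  obtain e3 where e3: "e3 \<in> boundary H {b} - parallel_edges H a b" using ex[of b] by blast
  then obtain w where w: "ends H e3 = {b, w}" "w \<noteq> a" "w \<noteq> b" "w \<in> verts H" using other[of e3 b] by blast
  have "\<exists>e1 e2 c d. switchable H r e1 e2 a b c d"
  proof (cases "ends H e = {b, d}")
    case True
    then have "switchable H r e1 e a b c d"
      using H e1 c d ab by unfold_locales auto
    then show ?thesis by blast
  next
    case False
    then have ad: "ends H e = {a, d}" using e by blast
    show ?thesis
    proof (cases "w = c")
      case True
      then have "switchable H r e e3 a b d w"
        using H e3 w d ad ab by unfold_locales auto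
      then show ?thesis by blast
    next
      case False
      then have "switchable H r e1 e3 a b c w"
        using H e1 c e3 w ab by unfold_locales auto
      then show ?thesis by blast
    qed
  qed
  then show thesis using that by blast
qed

text \<open>If \<open>r\<close> parallel edges join \<open>a\<close> and \<open>b\<close>, these two vertices form a component, which takes every color once.\<close>

lemma packs_full_if_multiplicity_full:
  assumes H: "r_graph r H" and ab: "a \<in> verts H" "b \<in> verts H" "a \<noteq> b"
    and eq: "card (parallel_edges H a b) = r"
    and rest: "verts H - {a, b} \<noteq> {} \<Longrightarrow> r_graph r (restrict_graph H (verts H - {a, b})) \<Longrightarrow>
      packs (restrict_graph H (verts H - {a, b})) r"
  shows "packs H r"
proof -
  note HD = r_graphD[OF H]
  let ?W = "verts H - {a, b}"
  have fin: "finite (parallel_edges H a b)" using HD(2) by (simp add: parallel_edges_def)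
  have bd: "boundary H {v} = parallel_edges H a b" if "v \<in> {a, b}" for v
  proof (rule sym, rule card_subset_eq)
    show "finite (boundary H {v})" using HD(2) by simp
    show "parallel_edges H a b \<subseteq> boundary H {v}" using parallel_edges_subset_boundary[of H a b] that by blast
    show "card (parallel_edges H a b) = card (boundary H {v})" using eq HD(6)[of v] ab that by auto
  qed
  have disj: "boundary H {v} \<inter> parallel_edges H a b = {}" if "v \<in> ?W" for v
  proof -
    have "v \<notin> ends H e" if "e \<in> parallel_edges H a b" for e
      using that \<open>v \<in> ?W\<close> by (simp add: parallel_edges_def)
    then show ?thesis by auto
  qed
  have inside: "ends H e \<subseteq> ?W" if e: "e \<in> edges H" "ends H e \<inter> ?W \<noteq> {}" for e
  proof -
    have "ends H e \<noteq> {a, b}" using e(2) by blast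
    then have "e \<notin> parallel_edges H a b" by (simp add: parallel_edges_def)
    then have "e \<notin> boundary H {a}" "e \<notin> boundary H {b}" by (simp_all only: bd insertI1 insertI2 simp_thms)
    then have "a \<notin> ends H e" "b \<notin> ends H e" using e(1) by simp_all
    then show ?thesis using HD(4)[OF e(1)] by blast
  qed
  have "\<exists>col. \<forall>v\<in>?W. bij_betw col (boundary H {v}) {..<r}"
  proof (cases "?W = {}")
    case False
    have semi: "semi_r_graph r (restrict_graph H ?W)"
      using H by (rule semi_r_graph_restrict_graph) simp
    have "card (ends H e \<inter> ?W) = 2" if "e \<in> edges H" "ends H e \<inter> ?W \<noteq> {}" for e
      using inside[OF that] HD(5)[OF that(1)] by (simp add: Int_absorb2)
    then have rg: "r_graph r (restrict_graph H ?W)"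
      unfolding r_graph_iff_semi_r_graph using semi False by simp
    then obtain col where "packing (restrict_graph H ?W) r col" using rest[OF False] unfolding packs_def by blast
    then have "\<forall>v\<in>?W. bij_betw col (boundary (restrict_graph H ?W) {v}) {..<r}"
      unfolding packing_full_iff[OF rg] by simp
    then have "\<forall>v\<in>?W. bij_betw col (boundary H {v}) {..<r}"
      by simp
    then show ?thesis by blast
  qed auto
  then obtain col where col: "\<forall>v\<in>?W. bij_betw col (boundary H {v}) {..<r}" by blast
  obtain h where h: "bij_betw h (parallel_edges H a b) {..<r}"
    using ex_bij_betw_finite_nat[OF fin] eq by (auto simp: atLeast0LessThan)
  define col' where "col' e = (if e \<in> parallel_edges H a b then h e else col e)" for e
  have "bij_betw col' (boundary H {v}) {..<r}" if v: "v \<in> verts H" for v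
  proof (cases "v \<in> {a, b}")
    case True
    have "bij_betw col' (parallel_edges H a b) {..<r} = bij_betw h (parallel_edges H a b) {..<r}"
      by (rule bij_betw_cong) (simp add: col'_def)
    then show ?thesis using h bd[OF True] by simp
  next
    case False
    then have vW: "v \<in> ?W" using v by blast
    have "bij_betw col' (boundary H {v}) {..<r} = bij_betw col (boundary H {v}) {..<r}"
      by (rule bij_betw_cong) (use disj[OF vW] in \<open>auto simp: col'_def\<close>)
    then show ?thesis using col vW by blast
  qed
  then show ?thesis unfolding packs_def packing_full_iff[OF H] by blast
qed

text \<open>An extremal argument: take a graph without \<open>r\<close> disjoint perfect matchings that has the fewest vertices
and, subject to this, the most parallel edges between some pair \<open>a\<close>, \<open>b\<close>. A switch that adds an edge
between \<open>a\<close> and \<open>b\<close> contradicts the choice unless the new graph does have \<open>r\<close> disjoint perfect matchings.\<close>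

lemma ex_r_graph_packs_minus_two:
  fixes H :: "('v, 'e) mgraph"
  assumes r: "r > 0" and H: "r_graph r H" "\<not> packs H r"
  obtains K :: "('v, 'e) mgraph"
  where "r_graph r K" "packs K (r - 2)" "\<not> packs K r" "card (verts K) \<le> card (verts H)"
proof -
  define bad :: "('v, 'e) mgraph \<Rightarrow> bool" where "bad K \<longleftrightarrow> r_graph r K \<and> \<not> packs K r" for K
  have "bad H" using H unfolding bad_def by blast
  then obtain K0 where K0: "bad K0" and K0_min: "\<And>K. bad K \<Longrightarrow> card (verts K0) \<le> card (verts K)"
    using ex_has_least_nat[of bad H "\<lambda>K. card (verts K)"] by blast
  define n where "n = card (verts K0)"
  have small: "packs K r" if "r_graph r K" "card (verts K) < n" for K :: "('v, 'e) mgraph"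
    using K0_min[of K] that unfolding bad_def n_def by linarith
  \<comment> \<open>The second choice ranges over triples, because the pair that carries the parallel edges is part
      of it.\<close>
  define Q where "Q = (\<lambda>(K, a, b). bad K \<and> card (verts K) = n \<and> a \<in> verts K \<and> b \<in> verts K \<and> a \<noteq> b)"
  define mult where "mult = (\<lambda>(K :: ('v, 'e) mgraph, a, b). card (parallel_edges K a b))"
  have bounded: "mult p \<le> r" if Qp: "Q p" for p
  proof -
    obtain K a b where p: "p = (K, a, b)" by (cases p)
    then have K: "r_graph r K" "a \<in> verts K" using Qp unfolding Q_def bad_def by auto
    have "card (parallel_edges K a b) \<le> card (boundary K {a})"
      using r_graphD(2)[OF K(1)] by (intro card_mono parallel_edges_subset_boundary) simp
    then show ?thesis unfolding mult_def p using r_graphD(6)[OF K] by simp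
  qed
  have "r_graph r K0" using K0 unfolding bad_def by blast
  then have "even (card (verts K0))" "card (verts K0) \<noteq> 0"
    using even_card_verts[OF _ r] r_graphD(1,3)[of r K0] by simp_all
  then have "2 \<le> card (verts K0)" by presburger
  then obtain A where A: "A \<subseteq> verts K0" "card A = 2" by (rule obtain_subset_with_card_n)
  then obtain a0 b0 where "A = {a0, b0}" "a0 \<noteq> b0" by (auto simp: card_2_iff)
  then have "Q (K0, a0, b0)" using A K0 unfolding Q_def n_def by simp
  then obtain p where "Q p" and p_max: "\<And>q. Q q \<Longrightarrow> mult q \<le> mult p"
    using ex_has_greatest_nat[of Q "(K0, a0, b0)" mult "Suc r"] bounded by (metis le_imp_less_Suc)
  obtain K a b where p: "p = (K, a, b)" by (cases p)
  have K: "r_graph r K" "\<not> packs K r" "card (verts K) = n"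
    and ab: "a \<in> verts K" "b \<in> verts K" "a \<noteq> b"
    using \<open>Q p\<close> unfolding Q_def bad_def p by auto
  note KD = r_graphD[OF K(1)]
  have "card (parallel_edges K a b) \<noteq> r"
  proof
    assume eq: "card (parallel_edges K a b) = r"
    have "packs K r"
    proof (rule packs_full_if_multiplicity_full[OF K(1) ab eq])
      have "verts K - {a, b} \<subset> verts K" using ab by blast
      then have "card (verts K - {a, b}) < n" using psubset_card_mono[OF KD(1)] K(3) by blast
      then show "packs (restrict_graph K (verts K - {a, b})) r"
        if "r_graph r (restrict_graph K (verts K - {a, b}))" using small[OF that] by simp
    qed
    then show False using K(2) by blast
  qed
  then have "card (parallel_edges K a b) < r"
    using bounded[OF \<open>Q p\<close>] unfolding p mult_def by simp
  then obtain e1 e2 c d where "switchable K r e1 e2 a b c d"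
    using ex_switchable[OF K(1) ab] by blast
  then interpret switchable K r e1 e2 a b c d .
  \<comment> \<open>Both contractions along a tight cut would be smaller, hence have \<open>r\<close> disjoint perfect matchings.\<close>
  have cuts: "r + 2 \<le> card (boundary K X)"
    if X: "X \<subseteq> verts K" "odd (card X)" "1 < card X" "1 < card (verts K - X)" for X
  proof (rule ccontr)
    assume "\<not> ?thesis"
    moreover have "r \<le> card (boundary K X)" using KD(7) X by blast
    moreover have "even (card (boundary K X)) \<longleftrightarrow> even (r * card X)"
      using K(1) X(1) by (intro even_card_boundary) (auto simp: r_graph_iff_semi_r_graph)
    moreover have "even (r * card X) \<longleftrightarrow> even r" using X(2) by simp
    ultimately have tight: "card (boundary K X) = r" by presburger
    have finX: "finite X" using X(1) KD(1) by (rule finite_subset)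
    have card_compl: "card (verts K - X) = card (verts K) - card X" "card X \<le> card (verts K)"
      using X(1) finX KD(1) by (simp_all add: card_Diff_subset card_mono)
    then have odd: "odd (card (verts K - X))" using even_card_verts[OF K(1) r] X(2) by simp
    have compl: "boundary K (verts K - X) = boundary K X"
      by (rule boundary_Diff) (use KD in blast)
    obtain z1 where z1: "z1 \<in> verts K - X" 
      using X(4) by (metis all_not_in_conv card.empty not_less_zero)
    obtain z2 where z2: "z2 \<in> X"
      using X(3) by (metis all_not_in_conv card.empty not_less_zero)
    have 1: "r_graph r (cap (restrict_graph K X) z1)"
      using X z1 tight by (intro r_graph_cap semi_r_graph_restrict_graph[OF K(1)]) auto
    have 2: "r_graph r (cap (restrict_graph K (verts K - X)) z2)"
      using odd z2 tight compl by (intro r_graph_cap semi_r_graph_restrict_graph[OF K(1)]) auto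
    have "packs (cap (restrict_graph K X) z1) r"
      using finX z1 card_compl X K(3) by (intro small[OF 1]) simp
    moreover have "packs (cap (restrict_graph K (verts K - X)) z2) r"
      using KD(1) z2 card_compl X K(3) by (intro small[OF 2]) simp
    ultimately have "packs K r"
      using packs_full_if_tight_cut[OF K(1) X(1) tight _ z2 1 _ 2] z1 by blast
    then show False using K(2) by blast
  qed
  have rg: "r_graph r H'" by (rule r_graph_switch[OF r cuts])
  have "packs H' r"
  proof (rule ccontr)
    assume "\<not> packs H' r"
    then have "Q (H', a, b)" unfolding Q_def bad_def using rg ab K(3) by simp
    then have "card (parallel_edges H' a b) \<le> card (parallel_edges K a b)"
      using p_max unfolding p mult_def by force
    moreover have "parallel_edges H' a b = insert e1 (parallel_edges K a b)"
      using e1 e2 neq e1_neq_e2 by (auto simp: parallel_edges_def doubleton_eq_iff)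
    moreover have "e1 \<notin> parallel_edges K a b" "finite (parallel_edges K a b)"
      using e1 neq KD(2) by (auto simp: parallel_edges_def doubleton_eq_iff)
    ultimately show False by simp
  qed
  then have "packs K (r - 2)" by (rule packs_if_packs_switch)
  then show thesis using that[of K] K K0_min[OF \<open>bad H\<close>] unfolding n_def by simp
qed

section \<open>Splitting off half-edges\<close>

text \<open>Joins the half-edge \<open>e1\<close> at \<open>a\<close> and the half-edge \<open>e2\<close> at \<open>b\<close> to an edge \<open>ab\<close>. The new edge keeps the
name \<open>e1\<close>, so that edges stay in the same type and a coloring only has to rename \<open>e2\<close> to \<open>e1\<close>.\<close>

definition split_off :: "('v, 'e) mgraph \<Rightarrow> 'e \<Rightarrow> 'e \<Rightarrow> 'v \<Rightarrow> 'v \<Rightarrow> ('v, 'e) mgraph" where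
  "split_off K e1 e2 a b = K\<lparr>edges := edges K - {e2}, ends := (ends K)(e1 := {a, b})\<rparr>"

lemma split_off_simps [simp]:
  "verts (split_off K e1 e2 a b) = verts K"
  "edges (split_off K e1 e2 a b) = edges K - {e2}"
  "ends (split_off K e1 e2 a b) = (ends K)(e1 := {a, b})"
  by (simp_all add: split_off_def)

text \<open>By the last assumption, no odd cut of size \<open>r\<close> loses the two edges that joining the half-edges at \<open>a\<close>
and \<open>b\<close> removes from it.\<close>

locale splittable =
  fixes K :: "('v, 'e) mgraph" and r e1 e2 a b
  assumes K: "semi_r_graph r K"
    and e1: "e1 \<in> edges K" "ends K e1 = {a}"
    and e2: "e2 \<in> edges K" "ends K e2 = {b}"
    and neq: "e1 \<noteq> e2" "a \<noteq> b"
    and loose: "\<And>X. X \<subseteq> verts K \<Longrightarrow> odd (card X) \<Longrightarrow> a \<in> X \<Longrightarrow> b \<in> X \<Longrightarrow> card (boundary K X) \<noteq> r"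
begin

abbreviation "K' \<equiv> split_off K e1 e2 a b"

lemma mem_boundary_split_off:
  "e \<in> boundary K' X \<longleftrightarrow>
    (if e = e1 then a \<in> X \<longleftrightarrow> b \<notin> X else if e = e2 then False else e \<in> boundary K X)"
  using e1 neq card_doubleton_Int_eq_1[OF neq(2), of X] unfolding boundary_def by auto

lemma mem_boundary_half_edges: "e1 \<in> boundary K X \<longleftrightarrow> a \<in> X" "e2 \<in> boundary K X \<longleftrightarrow> b \<in> X"
  using e1 e2 card_singleton_Int_eq_1[of a X] card_singleton_Int_eq_1[of b X] unfolding boundary_def by auto

lemma bij_betw_boundary_split_off:
  assumes "\<not> (a \<in> X \<and> b \<in> X)"
  shows "bij_betw (\<lambda>e. if e = e2 then e1 else e) (boundary K X) (boundary K' X)"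
proof (rule bij_betw_byWitness[where f' = "\<lambda>e. if e = e1 \<and> b \<in> X then e2 else e"])
  show "\<forall>e\<in>boundary K X.
      (if (if e = e2 then e1 else e) = e1 \<and> b \<in> X then e2 else (if e = e2 then e1 else e)) = e"
    using assms neq mem_boundary_half_edges[of X] by auto
  show "\<forall>e\<in>boundary K' X.
      (if (if e = e1 \<and> b \<in> X then e2 else e) = e2 then e1 else (if e = e1 \<and> b \<in> X then e2 else e)) = e"
    using neq mem_boundary_split_off[of _ X] by (auto split: if_splits)
  show "(\<lambda>e. if e = e2 then e1 else e) ` boundary K X \<subseteq> boundary K' X"
  proof
    fix e' assume "e' \<in> (\<lambda>e. if e = e2 then e1 else e) ` boundary K X"
    then obtain e where "e \<in> boundary K X" "e' = (if e = e2 then e1 else e)" by blast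
    then show "e' \<in> boundary K' X"
      using assms neq mem_boundary_half_edges[of X] unfolding mem_boundary_split_off
      by (cases "e = e1"; cases "e = e2") simp_all
  qed
  show "(\<lambda>e. if e = e1 \<and> b \<in> X then e2 else e) ` boundary K' X \<subseteq> boundary K X"
  proof
    fix e' assume "e' \<in> (\<lambda>e. if e = e1 \<and> b \<in> X then e2 else e) ` boundary K' X"
    then obtain e where "e \<in> boundary K' X" "e' = (if e = e1 \<and> b \<in> X then e2 else e)" by blast
    then show "e' \<in> boundary K X"
      using assms neq mem_boundary_half_edges[of X] unfolding mem_boundary_split_off
      by (cases "e = e1"; cases "e = e2"; cases "b \<in> X") simp_all
  qed
qed

text \<open>Only cuts of sets that contain both \<open>a\<close> and \<open>b\<close> lose edges, namely two; if such a set is odd, its cut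
does not have exactly \<open>r\<close> edges and so, by parity, has at least \<open>r + 2\<close>.\<close>

lemma semi_r_graph_split_off: "semi_r_graph r K'"
proof -
  note KD = semi_r_graphD[OF K]
  have "ends K' e \<subseteq> verts K' \<and> (card (ends K' e) = 1 \<or> card (ends K' e) = 2)" if "e \<in> edges K'" for e
  proof (cases "e = e1")
    case True
    then show ?thesis using KD(3)[OF e1(1)] KD(3)[OF e2(1)] e1 e2 neq by simp
  next
    case False
    then show ?thesis using K that unfolding semi_r_graph_def by simp
  qed
  moreover have "card (boundary K' {v}) = r" if "v \<in> verts K" for v
    using bij_betw_same_card[OF bij_betw_boundary_split_off[of "{v}"]] neq KD(4)[OF that] by force
  moreover have "r \<le> card (boundary K' X)" if X: "X \<subseteq> verts K" "odd (card X)" for X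
  proof (cases "a \<in> X \<and> b \<in> X")
    case False
    then show ?thesis
      using bij_betw_same_card[OF bij_betw_boundary_split_off[of X]] KD(5)[OF X] by simp
  next
    case True
    have "even (card (boundary K X)) \<longleftrightarrow> even r" using even_card_boundary[OF K X(1)] X(2) by simp
    moreover have "r \<le> card (boundary K X)" "card (boundary K X) \<noteq> r"
      using KD(5)[OF X] loose[OF X] True by blast+
    ultimately have "r + 2 \<le> card (boundary K X)" by presburger
    also have "boundary K X \<subseteq> boundary K' X \<union> {e1, e2}"
    proof
      fix e assume "e \<in> boundary K X"
      then show "e \<in> boundary K' X \<union> {e1, e2}"
        unfolding Un_iff mem_boundary_split_off by simp
    qed
    then have "card (boundary K X) \<le> card (boundary K' X \<union> {e1, e2})"
      using KD(2) by (intro card_mono) auto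
    also have "\<dots> \<le> card (boundary K' X) + card {e1, e2}" by (rule card_Un_le)
    also have "\<dots> = card (boundary K' X) + 2" using neq by simp
    finally show ?thesis by simp
  qed
  ultimately show ?thesis unfolding semi_r_graph_def using KD(1,2) by simp
qed

lemma local_coloring_split_off:
  assumes "local_coloring K G f"
  shows "local_coloring K' G (\<lambda>d. if f d = e2 then e1 else f d)"
  unfolding local_coloring_def
proof
  fix v assume "v \<in> verts G"
  then obtain u where u: "u \<in> verts K" "bij_betw f (boundary G {v}) (boundary K {u})"
    using assms unfolding local_coloring_def by blast
  have "\<not> (a \<in> {u} \<and> b \<in> {u})" using neq(2) by auto
  then have "bij_betw ((\<lambda>e. if e = e2 then e1 else e) \<circ> f) (boundary G {v}) (boundary K' {u})"
    by (intro bij_betw_trans[OF u(2)] bij_betw_boundary_split_off)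
  then show "\<exists>u\<in>verts K'. bij_betw (\<lambda>d. if f d = e2 then e1 else f d) (boundary G {v}) (boundary K' {u})"
    using u(1) by (auto simp: comp_def)
qed

end

text \<open>Uncrossing: if \<open>X \<inter> Y\<close> is odd, submodularity forces equality for \<open>X \<union> Y\<close>; if it is even, both
differences are odd and the half-edge at \<open>a\<close> contradicts the bound for them.\<close>

lemma tight_Un:
  assumes K: "semi_r_graph r K" and h: "h \<in> edges K" "ends K h = {a}"
    and X: "X \<subseteq> verts K" "odd (card X)" "card (boundary K X) = r" "a \<in> X"
    and Y: "Y \<subseteq> verts K" "odd (card Y)" "card (boundary K Y) = r" "a \<in> Y"
  shows "odd (card (X \<union> Y)) \<and> card (boundary K (X \<union> Y)) = r"
proof -
  note KD = semi_r_graphD[OF K]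
  have fin: "finite X" "finite Y" using X(1) Y(1) KD(1) finite_subset by auto
  have sum: "card X + card Y = card (X \<union> Y) + card (X \<inter> Y)" using fin by (rule card_Un_Int)
  have diff: "card X = card (X - Y) + card (X \<inter> Y)" "card Y = card (Y - X) + card (X \<inter> Y)"
    using fin by (metis Int_commute add.commute card_Int_Diff)+
  show ?thesis
  proof (cases "odd (card (X \<inter> Y))")
    case True
    then have odd_Un: "odd (card (X \<union> Y))" using sum X(2) Y(2) by presburger
    have "r \<le> card (boundary K (X \<inter> Y))" "r \<le> card (boundary K (X \<union> Y))"
      using True odd_Un X(1) Y(1) by (auto intro: KD(5))
    then show ?thesis using odd_Un boundary_submodular[OF K, of X Y] X(3) Y(3) by simp
  next
    case False
    then have "odd (card (X - Y))" "odd (card (Y - X))" using diff X(2) Y(2) by presburger+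
    then have "r \<le> card (boundary K (X - Y))" "r \<le> card (boundary K (Y - X))"
      using X(1) Y(1) by (auto intro: KD(5))
    then show ?thesis using boundary_posimodular[OF K h, of X Y] X(3,4) Y(3,4) by simp
  qed
qed

lemma mem_boundary_verts:
  assumes "semi_r_graph r K"
  shows "e \<in> boundary K (verts K) \<longleftrightarrow> e \<in> edges K \<and> card (ends K e) = 1"
  using semi_r_graphD(3)[OF assms] unfolding boundary_def by (auto simp: Int_absorb2)

text \<open>Fix a half-edge at \<open>a\<close> and a largest odd set \<open>X\<close> that contains \<open>a\<close> and has a cut of size \<open>r\<close>. By
uncrossing, a half-edge with end outside of \<open>X\<close> can be joined to the one at \<open>a\<close>. If there is none, all
half-edges belong to the cut of \<open>X\<close>, together with the edges between \<open>X\<close> and its complement. For an even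
number of vertices the complement is odd and its cut alone has at least \<open>r\<close> edges, so there is no half-edge; for an
odd number there are at most \<open>r\<close> half-edges, and at least \<open>r\<close> since they form the cut of an odd set.\<close>

lemma ex_splittable_or_few_half_edges:
  assumes K: "semi_r_graph r K"
  shows "(\<exists>e1 e2 a b. splittable K r e1 e2 a b) \<or>
    card (boundary K (verts K)) = (if even (card (verts K)) then 0 else r)"
proof (subst disj_imp, rule impI)
  assume none: "\<not> (\<exists>e1 e2 a b. splittable K r e1 e2 a b)"
  note KD = semi_r_graphD[OF K]
  let ?s = "card (boundary K (verts K))"
  have lower: "r \<le> ?s" if "odd (card (verts K))" using KD(5)[of "verts K"] that by simp
  show "?s = (if even (card (verts K)) then 0 else r)"
  proof (cases "boundary K (verts K) = {}")
    case True
    then show ?thesis using lower by auto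
  next
    case False
    then obtain h where h: "h \<in> edges K" "card (ends K h) = 1" using mem_boundary_verts[OF K] by blast
    then obtain a where a: "ends K h = {a}" using card_1_singletonE by blast
    have aV: "a \<in> verts K" using KD(3)[OF h(1)] a by simp
    define T where "T X \<longleftrightarrow> X \<subseteq> verts K \<and> odd (card X) \<and> card (boundary K X) = r \<and> a \<in> X" for X
    have "T {a}" using aV KD(4)[OF aV] unfolding T_def by simp
    moreover have "\<forall>X. T X \<longrightarrow> card X < Suc (card (verts K))"
      using card_mono[OF KD(1)] unfolding T_def by (simp add: less_Suc_eq_le)
    ultimately obtain X where "T X" and X_max: "\<And>Y. T Y \<Longrightarrow> card Y \<le> card X"
      using ex_has_greatest_nat[of T "{a}" card] by blast
    then have X: "X \<subseteq> verts K" "odd (card X)" "card (boundary K X) = r" "a \<in> X" unfolding T_def by auto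
    have finX: "finite X" using X(1) KD(1) by (rule finite_subset)
    have half_X: "ends K e \<subseteq> X" if e: "e \<in> edges K" "card (ends K e) = 1" for e
    proof (rule ccontr)
      assume "\<not> ends K e \<subseteq> X"
      moreover obtain b where b: "ends K e = {b}" using e(2) by (rule card_1_singletonE)
      ultimately have "b \<notin> X" by simp
      have "card (boundary K Y) \<noteq> r" if Y: "Y \<subseteq> verts K" "odd (card Y)" "a \<in> Y" "b \<in> Y" for Y
      proof
        assume "card (boundary K Y) = r"
        then have "T (X \<union> Y)"
          using tight_Un[OF K h(1) a X Y(1,2) _ Y(3)] X Y unfolding T_def by simp
        then have "card (X \<union> Y) \<le> card X" by (rule X_max)
        moreover have "finite (X \<union> Y)" using finX Y(1) KD(1) finite_subset by auto
        then have "card X < card (X \<union> Y)"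
          using \<open>b \<notin> X\<close> Y(4) by (intro psubset_card_mono) auto
        ultimately show False by simp
      qed
      then have "splittable K r h e a b"
        using K h(1) a e(1) b \<open>b \<notin> X\<close> X(4) by unfold_locales auto
      then show False using none by blast
    qed
    have "boundary K (verts K - X) \<union> boundary K (verts K) \<subseteq> boundary K X"
    proof
      fix e assume e: "e \<in> boundary K (verts K - X) \<union> boundary K (verts K)"
      then have eE: "e \<in> edges K" by (auto simp: boundary_def)
      then show "e \<in> boundary K X"
      proof (rule semi_r_graph_ends_cases[OF K])
        fix p assume p: "ends K e = {p}"
        then have "p \<in> X" using half_X[OF eE] by simp
        then show ?thesis using eE p unfolding boundary_def by simp
      next
        fix p q assume pq: "ends K e = {p, q}" "p \<noteq> q" and V: "p \<in> verts K" "q \<in> verts K"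
        have "e \<notin> boundary K (verts K)" using mem_boundary_verts[OF K] pq by simp
        then have "card (ends K e \<inter> (verts K - X)) = 1" using e unfolding boundary_def by blast
        then have "card (ends K e \<inter> X) = 1"
          using V unfolding pq(1) card_doubleton_Int_eq_1[OF pq(2)] by blast
        then show ?thesis using eE unfolding boundary_def by simp
      qed
    qed
    then have "card (boundary K (verts K - X) \<union> boundary K (verts K)) \<le> r"
      using X(3) KD(2) by (metis card_mono finite_boundary)
    moreover have "boundary K (verts K - X) \<inter> boundary K (verts K) = {}"
    proof (rule ccontr)
      assume "\<not> ?thesis"
      then obtain e where e: "e \<in> boundary K (verts K - X)" "e \<in> boundary K (verts K)" by blast
      then have "ends K e \<inter> (verts K - X) = {}" using half_X mem_boundary_verts[OF K] by blast
      then show False using e(1) unfolding boundary_def by simp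
    qed
    ultimately have sum: "card (boundary K (verts K - X)) + ?s \<le> r"
      using KD(2) by (simp add: card_Un_disjoint)
    have "?s > 0" using False KD(2) by (simp add: card_gt_0_iff)
    show ?thesis
    proof (cases "even (card (verts K))")
      case True
      have "card (verts K - X) = card (verts K) - card X" "card X \<le> card (verts K)"
        using X(1) finX KD(1) by (simp_all add: card_Diff_subset card_mono)
      then have "odd (card (verts K - X))" using True X(2) by simp
      then have "r \<le> card (boundary K (verts K - X))" by (intro KD(5)) auto
      then show ?thesis using sum \<open>?s > 0\<close> by simp
    next
      case odd: False
      then show ?thesis using sum lower by simp
    qed
  qed
qed

lemma ex_few_half_edges:
  fixes K :: "('v, 'e) mgraph"
  assumes "semi_r_graph r K" and "local_coloring K G f"
  shows "\<exists>(L :: ('v, 'e) mgraph) g. semi_r_graph r L \<and> local_coloring L G g \<and> verts L = verts K \<and>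
    card (boundary L (verts L)) = (if even (card (verts L)) then 0 else r)"
  using assms
proof (induction "card (edges K)" arbitrary: K f rule: less_induct)
  case less
  show ?case
  proof (cases "\<exists>e1 e2 a b. splittable K r e1 e2 a b")
    case True
    then obtain e1 e2 a b where "splittable K r e1 e2 a b" by blast
    then interpret splittable K r e1 e2 a b .
    have "card (edges K') < card (edges K)"
      using e2(1) semi_r_graphD(2)[OF K] by (intro psubset_card_mono) auto
    from less.hyps[OF this semi_r_graph_split_off local_coloring_split_off[OF less.prems(2)]]
    show ?thesis by simp
  next
    case False
    then have "card (boundary K (verts K)) = (if even (card (verts K)) then 0 else r)"
      using ex_splittable_or_few_half_edges[OF less.prems(1)] by argo
    then show ?thesis using less.prems by blast
  qed
qed

lemma ex_r_graph_coloring: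
  fixes K :: "('v, 'e) mgraph"
  assumes K: "semi_r_graph r K" "local_coloring K G f" and ne: "verts K \<noteq> {}" and z: "z \<notin> verts K"
  obtains L :: "('v, 'e) mgraph" and g
  where "r_graph r L" "local_coloring L G g" "card (verts L) \<le> Suc (card (verts K))"
proof -
  obtain L :: "('v, 'e) mgraph" and g where L: "semi_r_graph r L" "local_coloring L G g" "verts L = verts K"
    and s: "card (boundary L (verts L)) = (if even (card (verts L)) then 0 else r)"
    using ex_few_half_edges[OF K] by blast
  note LD = semi_r_graphD[OF L(1)]
  show thesis
  proof (cases "even (card (verts L))")
    case True
    then have "boundary L (verts L) = {}" using s LD(2) by simp
    then have "card (ends L e) = 2" if "e \<in> edges L" for e
      using L(1) that mem_boundary_verts[OF L(1), of e] unfolding semi_r_graph_def by blast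
    then have "r_graph r L" unfolding r_graph_iff_semi_r_graph using L ne by simp
    then show thesis using that[of L g] L by simp
  next
    case False
    have z': "z \<notin> verts L" using z L(3) by simp
    have "r_graph r (cap L z)" using False s by (intro r_graph_cap L(1) z') simp_all
    moreover have "local_coloring (cap L z) G g" unfolding local_coloring_def
    proof
      fix v assume "v \<in> verts G"
      then obtain u where u: "u \<in> verts L" "bij_betw g (boundary G {v}) (boundary L {u})"
        using L(2) unfolding local_coloring_def by blast
      then have "boundary (cap L z) {u} = boundary L {u}" using z' by (intro boundary_cap) auto
      then show "\<exists>u\<in>verts (cap L z). bij_betw g (boundary G {v}) (boundary (cap L z) {u})"
        using u by (intro bexI[of _ u]) simp_all
    qed
    moreover have "card (verts (cap L z)) \<le> Suc (card (verts K))"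
      using L(3) by (simp add: card_insert_le_m1 card_insert_if LD(1))
    ultimately show thesis by (rule that)
  qed
qed

section \<open>Colorings of minimal r-graphs\<close>

lemma packs_full_if_two_vertices:
  assumes G: "r_graph r G" and "card (verts G) = 2"
  shows "packs G r"
proof -
  note GD = r_graphD[OF G]
  obtain v where v: "v \<in> verts G" using GD(3) by blast
  have "ends G e = verts G" if "e \<in> edges G" for e
    using card_subset_eq[OF GD(1) GD(4)[OF that]] GD(5)[OF that] assms(2) by simp
  then have bd: "boundary G {u} = edges G" if "u \<in> verts G" for u using that by auto
  have "card (edges G) = r" using GD(6)[OF v] bd[OF v] by simp
  then obtain c where "bij_betw c (edges G) {..<r}"
    using ex_bij_betw_finite_nat[OF GD(2)] by (auto simp: atLeast0LessThan)
  then show ?thesis unfolding packs_def packing_full_iff[OF G] using bd by auto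
qed

lemma min_r_graphs_le:
  fixes G :: "('w, 'd) mgraph" and K :: "('v, 'e) mgraph"
  assumes G: "G \<in> min_r_graphs r k" and K: "r_graph r K" "pm_number K = k"
  shows "card (verts G) \<le> card (verts K)"
proof -
  obtain K' :: "(nat, nat) mgraph"
    where K': "r_graph r K'" "\<And>t. packs K' t \<longleftrightarrow> packs K t" "card (verts K') = card (verts K)"
    using ex_nat_copy[OF K(1)] by blast
  have "t \<le> pm_number K' \<longleftrightarrow> t \<le> pm_number K" for t
    using le_pm_number_iff_packs[OF K'(1)] le_pm_number_iff_packs[OF K(1)] K'(2) by simp
  then have "pm_number K' = k" using K(2) by (metis order_antisym order_refl)
  then show ?thesis using G K'(1,3) unfolding min_r_graphs_def by auto
qed

text \<open>The graph \<open>H\<close> need not satisfy \<open>\<pi>(H) = \<pi>(G)\<close>, so minimality of \<open>G\<close> cannot be applied to it directly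
when \<open>k = r - 2\<close>; it is applied to a graph that is not larger and has \<open>\<pi> = r - 2\<close>, since \<open>\<pi> = r - 1\<close>
is impossible.\<close>

lemma card_verts_le_if_local_coloring:
  fixes G :: "('w, 'd) mgraph" and H :: "('v, 'e) mgraph"
  assumes r: "r \<ge> 3" and G: "G \<in> min_r_graphs r (r - 2) \<union> min_r_graphs r 1"
    and H: "r_graph r H" and f: "local_coloring H G f"
  shows "card (verts G) \<le> card (verts H)"
  using G
proof
  assume G2: "G \<in> min_r_graphs r (r - 2)"
  then have Gr: "r_graph r G" "pm_number G = r - 2" unfolding min_r_graphs_def by auto
  then have "\<not> r \<le> pm_number G" using r by linarith
  then have "\<not> packs G r" using le_pm_number_iff_packs[OF Gr(1)] by blast
  then have "\<not> packs H r" using packs_if_local_coloring[OF f] by blast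
  then obtain K :: "('v, 'e) mgraph" where K: "r_graph r K" "packs K (r - 2)" "\<not> packs K r"
    and le: "card (verts K) \<le> card (verts H)"
    using ex_r_graph_packs_minus_two[OF _ H] r by (metis gr0I not_numeral_le_zero)
  have "Suc (r - 1) = r" "Suc (r - 2) = r - 1" using r by simp_all
  then have "\<not> packs K (Suc (r - 2))"
    using packs_full_if_packs_pred[of "r - 1" K] K(1,3) by auto
  then have "pm_number K = r - 2" using K by (intro pm_number_eqI)
  then have "card (verts G) \<le> card (verts K)" by (rule min_r_graphs_le[OF G2 K(1)])
  then show ?thesis using le by simp
next
  assume G1: "G \<in> min_r_graphs r 1"
  then have Gr: "r_graph r G" "pm_number G = 1" unfolding min_r_graphs_def by auto
  then have "\<not> packs G (Suc 1)" using le_pm_number_iff_packs[OF Gr(1), of "Suc 1"] by simp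
  then have "\<not> packs H (Suc 1)" using packs_if_local_coloring[OF f] by blast
  moreover have "packs H 1" using packs_one_if_r_graph[OF H] r by simp
  ultimately have "pm_number H = 1" using H by (intro pm_number_eqI)
  then show ?thesis by (rule min_r_graphs_le[OF G1 H])
qed

text \<open>The edges of color \<open>e\<close> form a perfect matching of the vertices that \<open>F\<close> sends to an end of \<open>e\<close>.\<close>

lemma card_two_fibres:
  assumes H: "r_graph r H" and G: "r_graph r G"
    and F: "\<And>v. v \<in> verts G \<Longrightarrow> bij_betw f (boundary G {v}) (boundary H {F v})"
    and e: "e \<in> edges H"
  shows "card {v \<in> verts G. F v \<in> ends H e} = 2 * card {d \<in> edges G. f d = e}"
proof -
  note GD = r_graphD[OF G]
  let ?D = "{d \<in> edges G. f d = e}"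
  have "2 * card ?D = (\<Sum>d\<in>?D. card (ends G d))" using GD(5) by simp
  also have "\<dots> = card (\<Union>d\<in>?D. ends G d)"
  proof (rule card_UN_disjoint[symmetric])
    show "finite ?D" using GD(2) by simp
    show "\<forall>d\<in>?D. finite (ends G d)" using GD(1,4) by (auto intro: finite_subset)
    show "\<forall>d\<in>?D. \<forall>d'\<in>?D. d \<noteq> d' \<longrightarrow> ends G d \<inter> ends G d' = {}"
    proof (intro ballI impI, rule ccontr)
      fix d d' assume d: "d \<in> ?D" "d' \<in> ?D" "d \<noteq> d'" "ends G d \<inter> ends G d' \<noteq> {}"
      then obtain v where v: "v \<in> ends G d" "v \<in> ends G d'" by blast
      then have "v \<in> verts G" using GD(4) d by blast
      then have "inj_on f (boundary G {v})" using F by (simp add: bij_betw_def)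
      then show False using d v by (auto simp: inj_on_def)
    qed
  qed
  also have "(\<Union>d\<in>?D. ends G d) = {v \<in> verts G. F v \<in> ends H e}"
  proof (intro equalityI subsetI)
    fix v assume "v \<in> (\<Union>d\<in>?D. ends G d)"
    then obtain d where d: "d \<in> edges G" "f d = e" "v \<in> ends G d" by blast
    then have v: "v \<in> verts G" using GD(4) by blast
    then have "e \<in> boundary H {F v}" using bij_betwE[OF F[OF v]] d by auto
    then show "v \<in> {v \<in> verts G. F v \<in> ends H e}" using v by simp
  next
    fix v assume v: "v \<in> {v \<in> verts G. F v \<in> ends H e}"
    then have "e \<in> boundary H {F v}" using e by simp
    moreover have "boundary H {F v} = f ` boundary G {v}"
      using bij_betw_imp_surj_on[OF F] v by simp
    ultimately have "e \<in> f ` boundary G {v}" by simp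
    then obtain d where d: "d \<in> boundary G {v}" "e = f d" by (rule imageE)
    then have "d \<in> ?D" "v \<in> ends G d" by simp_all
    then show "v \<in> (\<Union>d\<in>?D. ends G d)" by (rule UN_I)
  qed
  finally show ?thesis by simp
qed

lemma fibres_same_parity:
  assumes H: "r_graph r H" "connected_graph H" and G: "r_graph r G"
    and F: "\<And>v. v \<in> verts G \<Longrightarrow> bij_betw f (boundary G {v}) (boundary H {F v})"
    and uw: "u \<in> verts H" "w \<in> verts H"
  shows "even (card {v \<in> verts G. F v = u}) \<longleftrightarrow> even (card {v \<in> verts G. F v = w})"
proof -
  let ?n = "\<lambda>u. card {v \<in> verts G. F v = u}"
  have "(u, w) \<in> {(x, y). \<exists>e\<in>edges H. ends H e = {x, y}}\<^sup>*"
    using H(2) uw unfolding connected_graph_def by blast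
  then show ?thesis
  proof (induction rule: rtrancl_induct)
    case (step x y)
    then obtain e where e: "e \<in> edges H" "ends H e = {x, y}" by blast
    then have "x \<noteq> y" using r_graphD(5)[OF H(1) e(1)] by auto
    have "{v \<in> verts G. F v \<in> ends H e} = {v \<in> verts G. F v = x} \<union> {v \<in> verts G. F v = y}"
      using e(2) by auto
    then have "card {v \<in> verts G. F v \<in> ends H e} = ?n x + ?n y"
      using r_graphD(1)[OF G] \<open>x \<noteq> y\<close> by (simp only:) (subst card_Un_disjoint, auto)
    then have "?n x + ?n y = 2 * card {d \<in> edges G. f d = e}"
      using card_two_fibres[OF H(1) G F e(1)] by simp
    then have "even (?n x + ?n y)" by (metis dvd_triv_left)
    then show ?case using step.IH by simp
  qed simp
qed

text \<open>By \<open>card_two_fibres\<close> each color is used exactly once, so \<open>f\<close> is a bijection between the edges as well.\<close>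

lemma graph_iso_if_bij_betw:
  assumes H: "r_graph r H" and G: "r_graph r G" and "H_coloring H G f"
    and F: "\<And>v. v \<in> verts G \<Longrightarrow> bij_betw f (boundary G {v}) (boundary H {F v})"
    and bij: "bij_betw F (verts G) (verts H)"
  shows "H \<cong> G"
proof -
  note GD = r_graphD[OF G] and HD = r_graphD[OF H]
  have f_edges: "f d \<in> edges H" if "d \<in> edges G" for d
    using assms(3) that unfolding H_coloring_def by blast
  have F_ends: "F ` ends G d = ends H (f d)" if d: "d \<in> edges G" for d
  proof (rule card_subset_eq)
    have sub: "ends G d \<subseteq> verts G" using GD(4)[OF d] .
    show "finite (ends H (f d))" using HD(1) HD(4)[OF f_edges[OF d]] by (rule rev_finite_subset)
    show "F ` ends G d \<subseteq> ends H (f d)"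
    proof
      fix u assume "u \<in> F ` ends G d"
      then obtain v where v: "v \<in> ends G d" "u = F v" by blast
      then have "v \<in> verts G" "d \<in> boundary G {v}" using sub d by auto
      then have "f d \<in> boundary H {F v}" using bij_betwE[OF F] by blast
      then show "u \<in> ends H (f d)" using v(2) by simp
    qed
    have "inj_on F (ends G d)" using bij sub by (meson bij_betw_imp_inj_on inj_on_subset)
    then show "card (F ` ends G d) = card (ends H (f d))"
      using GD(5)[OF d] HD(5)[OF f_edges[OF d]] by (simp add: card_image)
  qed
  have one: "card {d \<in> edges G. f d = e} = 1" if e: "e \<in> edges H" for e
  proof -
    have "F ` {v \<in> verts G. F v \<in> ends H e} = ends H e"
    proof
      show "ends H e \<subseteq> F ` {v \<in> verts G. F v \<in> ends H e}"
      proof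
        fix u assume u: "u \<in> ends H e"
        then have "u \<in> F ` verts G" using bij_betw_imp_surj_on[OF bij] HD(4)[OF e] by blast
        then show "u \<in> F ` {v \<in> verts G. F v \<in> ends H e}" using u by blast
      qed
    qed blast
    moreover have "inj_on F {v \<in> verts G. F v \<in> ends H e}"
      using bij_betw_imp_inj_on[OF bij] by (rule inj_on_subset) blast
    ultimately have "card {v \<in> verts G. F v \<in> ends H e} = 2" using HD(5)[OF e] card_image by metis
    then show ?thesis using card_two_fibres[OF H G F e] by simp
  qed
  have f_bij: "bij_betw f (edges G) (edges H)"
    unfolding bij_betw_def
  proof
    show "inj_on f (edges G)"
    proof (rule inj_onI)
      fix d d' assume d: "d \<in> edges G" "d' \<in> edges G" "f d = f d'"
      obtain x where "{d'' \<in> edges G. f d'' = f d} = {x}"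
        using one[OF f_edges[OF d(1)]] by (rule card_1_singletonE)
      moreover have "d \<in> {d'' \<in> edges G. f d'' = f d}" "d' \<in> {d'' \<in> edges G. f d'' = f d}" using d by simp_all
      ultimately show "d = d'" by (metis singletonD)
    qed
    have "e \<in> f ` edges G" if e: "e \<in> edges H" for e
    proof -
      obtain x where "{d \<in> edges G. f d = e} = {x}" using one[OF e] by (rule card_1_singletonE)
      then have "x \<in> {d \<in> edges G. f d = e}" by simp
      then show ?thesis by (auto intro: rev_image_eqI)
    qed
    then show "f ` edges G = edges H" using f_edges by blast
  qed
  let ?\<phi> = "inv_into (verts G) F" and ?\<psi> = "inv_into (edges G) f"
  have "ends G (?\<psi> e) = ?\<phi> ` ends H e" if e: "e \<in> edges H" for e
  proof -
    have d: "?\<psi> e \<in> edges G" "f (?\<psi> e) = e"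
      using e f_bij by (simp_all add: bij_betw_def inv_into_into f_inv_into_f)
    have "?\<phi> ` ends H e = ?\<phi> ` F ` ends G (?\<psi> e)" using F_ends[OF d(1)] d(2) by simp
    also have "\<dots> = ends G (?\<psi> e)"
      using bij_betw_imp_inj_on[OF bij] GD(4)[OF d(1)] by (rule inv_into_image_cancel)
    finally show ?thesis by simp
  qed
  then show ?thesis
    unfolding graph_iso_def using bij_betw_inv_into[OF bij] bij_betw_inv_into[OF f_bij] by blast
qed

theorem theorem3p6:
  fixes H :: "('v, 'e) mgraph" and G :: "('w, 'd) mgraph" and r :: nat
  assumes "r \<ge> 3"
    and "r_graph r H" and "connected_graph H"
    and "G \<in> min_r_graphs r (r - 2) \<union> min_r_graphs r 1"
    and "H \<prec> G"
  shows "H \<cong> G"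
proof -
  have G: "r_graph r G" and pm: "pm_number G < r"
    using assms(1,4) unfolding min_r_graphs_def by auto
  note GD = r_graphD[OF G] and HD = r_graphD[OF assms(2)]
  have minimal: "card (verts G) \<le> card (verts K)"
    if "r_graph r K" "local_coloring K G g" for K :: "('v, 'e) mgraph" and g
    using card_verts_le_if_local_coloring[OF assms(1,4) that] .
  obtain f where f: "H_coloring H G f" using assms(5) unfolding colors_def by blast
  have loc: "local_coloring H G f" using f by (rule local_coloring_if_H_coloring)
  then have "\<forall>v\<in>verts G. \<exists>u. u \<in> verts H \<and> bij_betw f (boundary G {v}) (boundary H {u})"
    unfolding local_coloring_def by blast
  then obtain F where F: "\<forall>v\<in>verts G. F v \<in> verts H \<and> bij_betw f (boundary G {v}) (boundary H {F v})"
    by (rule bchoice[THEN exE])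
  have F_bij: "bij_betw f (boundary G {v}) (boundary H {F v})" if "v \<in> verts G" for v
    using F that by blast
  define W where "W = F ` verts G"
  have W_sub: "W \<subseteq> verts H" using F unfolding W_def by blast
  have "W = verts H"
  proof (rule ccontr)
    assume "W \<noteq> verts H"
    then obtain z where z: "z \<in> verts H" "z \<notin> W" using W_sub by blast
    let ?n = "\<lambda>u. card {v \<in> verts G. F v = u}"
    have "{v \<in> verts G. F v = z} = {}" using z(2) unfolding W_def by blast
    then have "even (?n z)" by (simp only: card.empty even_zero)
    then have n_even: "even (?n u)" if "u \<in> W" for u
      using fibres_same_parity[OF assms(2,3) G F_bij, of u z] that W_sub z(1) by blast
    \<comment> \<open>The fibre over \<open>z\<close> is empty, so all fibres are even.\<close>
    have n_ge: "2 \<le> ?n u" if u: "u \<in> W" for u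
    proof -
      have "{v \<in> verts G. F v = u} \<noteq> {}" using u unfolding W_def by blast
      then have "?n u \<noteq> 0" using GD(1) by simp
      then show ?thesis using n_even[OF u] by presburger
    qed
    have "finite W" using GD(1) unfolding W_def by simp
    have "card W * 2 \<le> (\<Sum>u\<in>W. ?n u)" using sum_bounded_below[of W 2 ?n, OF n_ge] by simp
    also have "\<dots> = card (verts G)"
      using sum_fun_comp[OF GD(1) \<open>finite W\<close>, of F "\<lambda>_. 1::nat"] by (simp add: W_def)
    finally have half: "2 * card W \<le> card (verts G)" by simp
    have "local_coloring (restrict_graph H W) G f"
      unfolding local_coloring_def
    proof
      fix v assume v: "v \<in> verts G"
      then have "F v \<in> W" unfolding W_def by blast
      then show "\<exists>u\<in>verts (restrict_graph H W). bij_betw f (boundary G {v}) (boundary (restrict_graph H W) {u})"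
        using F_bij[OF v] by (intro bexI[of _ "F v"]) simp_all
    qed
    then obtain L :: "('v, 'e) mgraph" and g where L: "r_graph r L" "local_coloring L G g"
      and "card (verts L) \<le> Suc (card W)"
      using ex_r_graph_coloring[OF semi_r_graph_restrict_graph[OF assms(2) W_sub]] z(2) GD(3)
      unfolding W_def by (metis image_is_empty restrict_graph_simps(1))
    then have "card (verts G) \<le> Suc (card W)" using minimal[OF L] by simp
    moreover have "card (verts G) \<noteq> 0" using GD(1,3) by simp
    moreover have "even (card (verts G))" using even_card_verts[OF G] assms(1) by simp
    ultimately have "card (verts G) = 2" using half by presburger
    then have "packs G r" by (rule packs_full_if_two_vertices[OF G])
    then have "r \<le> pm_number G" using le_pm_number_iff_packs[OF G] by blast
    then show False using pm by simp
  qed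
  then have surj: "F ` verts G = verts H" unfolding W_def .
  have "card (F ` verts G) = card (verts G)"
    using minimal[OF assms(2) loc] card_image_le[OF GD(1), of F] surj by simp
  then have "inj_on F (verts G)" using GD(1) by (intro eq_card_imp_inj_on)
  then have bij: "bij_betw F (verts G) (verts H)" using surj by (simp add: bij_betw_def)
  show ?thesis by (rule graph_iso_if_bij_betw[OF assms(2) G f F_bij bij])
qed

end
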